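(* Let $L$, $\mu$, $\Psi$, $\Phi$, $\mathcal{A}$, $\mathcal{P}_\delta$, $\mathcal{C}$ be as described in the context. For any $\delta>0$ there exist a maximizer $V_\delta$ of the problem $$\text{maximize }\mathcal{P}_\delta(V)\quad\text{subject to}\quad\|V\|_2=1\ \text{ and }\ V\in\mathcal{C}$$ and a Lagrangian multiplier $\lambda_\delta^2>0$ such that, with $R_\delta:=\mathcal{A}V_\delta$: 1. the traveling wave equations $$\lambda_\delta^2V_\delta=\frac1\delta\,\mathcal{A}\,\Phi'\left(\frac{\mathcal{A}V_\delta}{\delta}\right)$$ and, for all $x\in\mathbb{R}$, $$R_\delta'(x)=V_\delta\left(x+\tfrac12\right)-V_\delta\left(x-\tfrac12\right),\qquad V_\delta'(x)=\frac{1}{\delta\lambda_\delta^2}\left(\Phi'\left(\frac{R_\delta(x+\frac12)}{\delta}\right)-\Phi'\left(\frac{R_\delta(x-\frac12)}{\delta}\right)\right)$$ are satisfied; 2. $V_\delta$ fulfills the norm constraint $\|V_\delta\|_2=1$; 3. both $V_\delta$ and $R_\delta$ are $2L$-periodic, belong to $\mathcal{C}$, and are pointwise positive. Moreover, $$\|V_\delta-V_0\|_2+\|R_\delta-R_0\|_\infty\;\longrightarrow\;0\qquad\text{as }\delta\to0,$$ where $V_0$ is the ($2L$-periodically extended) indicator function of the interval $[-\frac12,\frac12]$ and $R_0=\mathcal{A}V_0$ is a tent map.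
   Context: Standing assumptions. Fix a real number $2<L<\infty$, a parameter $\mu\in\mathbb{R}$, and write $\mathbb{R}_+=[0,\infty)$. The force function is $\Phi'(r)=\Psi(r)\exp(r)$ for $r\ge0$, where $\Psi:\mathbb{R}_+\to\mathbb{R}_+$ is continuously differentiable, $\Psi(0)=0$, and there is a constant $C_\Psi>0$ such that for all $r>0$: $\Psi(r)>0$, $\Psi'(r)+\Psi(r)\ge0$ and $\left|\Psi(r)/r^\mu-1\right|\le C_\Psi/r$. The potential $\Phi:\mathbb{R}_+\to\mathbb{R}$ is an antiderivative of $\Phi'$ (in particular, it is convex and minimal at $0$). Notation. All profiles are $2L$-periodic functions on $\mathbb{R}$; $\|\cdot\|_p$ is the Lebesgue norm on $[-L,L]$. For a $2L$-periodic $V$ put $(\mathcal{A}V)(x):=\int_{x-1/2}^{x+1/2}V(\tilde x)\,d\tilde x$ and $\mathcal{P}_\delta(V):=\int_{-L}^{L}\Phi\left((\mathcal{A}V)(x)/\delta\right)dx$. The cone $\mathcal{C}$ consists of all $2L$-periodic, square-integrable (on $[-L,L]$) functions $V$ with $V(-x)=V(x)\ge V(\tilde x)\ge0$ for almost all $0\le x\le\tilde x\le L$. Pointwise statements about $V_\delta$ refer to its continuous representative. *)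

theory Defs
  imports "HOL-Probability.Essential_Supremum" "HOL-Library.Periodic_Fun"
begin

definition avg :: "(real \<Rightarrow> real) \<Rightarrow> real \<Rightarrow> real" where
  "avg V x = (LINT t:{x - 1/2..x + 1/2}|lebesgue. V t)"

definition force :: "(real \<Rightarrow> real) \<Rightarrow> real \<Rightarrow> real" where
  "force \<Psi> r = \<Psi> r * exp r"

definition potential_energy :: "real \<Rightarrow> (real \<Rightarrow> real) \<Rightarrow> real \<Rightarrow> (real \<Rightarrow> real) \<Rightarrow> real" where
  "potential_energy L \<Phi> \<delta> V = (LINT x:{-L..L}|lebesgue. \<Phi> (avg V x / \<delta>))"

(* Equals 0 if the square of V is not integrable; it is only used below for
   functions that are square-integrable on [-L, L]. *)
definition L2_norm_on :: "real \<Rightarrow> (real \<Rightarrow> real) \<Rightarrow> real" where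
  "L2_norm_on L V = sqrt (LINT x:{-L..L}|lebesgue. (V x)\<^sup>2)"

definition Linf_norm_on :: "real \<Rightarrow> (real \<Rightarrow> real) \<Rightarrow> ereal" where
  "Linf_norm_on L V = esssup (lebesgue_on {-L..L}) (\<lambda>x. ereal \<bar>V x\<bar>)"

(* Elements are functions, not classes modulo null sets: periodicity is required at every
   point, symmetry and monotonicity for almost every pair (x, y) with respect to
   planar Lebesgue measure. *)
definition profile_cone :: "real \<Rightarrow> (real \<Rightarrow> real) set" where
  "profile_cone L = {V. periodic_fun_simple V (2 * L)
    \<and> set_borel_measurable lebesgue {-L..L} V
    \<and> set_integrable lebesgue {-L..L} (\<lambda>x. (V x)\<^sup>2)
    \<and> (AE (x, y) in (lebesgue :: (real \<times> real) measure).
         0 \<le> x \<and> x \<le> y \<and> y \<le> L \<longrightarrow> V (-x) = V x \<and> V x \<ge> V y \<and> V y \<ge> 0)}"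

definition maximizer :: "real \<Rightarrow> (real \<Rightarrow> real) \<Rightarrow> real \<Rightarrow> (real \<Rightarrow> real) \<Rightarrow> bool" where
  "maximizer L \<Phi> \<delta> V \<longleftrightarrow>
     is_arg_max (potential_energy L \<Phi> \<delta>) (\<lambda>W. L2_norm_on L W = 1 \<and> W \<in> profile_cone L) V"

definition limit_velocity :: "real \<Rightarrow> real \<Rightarrow> real" where
  "limit_velocity L x = indicator (\<Union>k::int. {2 * L * k - 1/2..2 * L * k + 1/2}) x"

definition limit_distance :: "real \<Rightarrow> real \<Rightarrow> real" where
  "limit_distance L = avg (limit_velocity L)"

end

theory Submission
  imports Defs "HOL-Complex_Analysis.Great_Picard"
begin

text \<open>
  Averaging over unit windows is self-adjoint and maps the cone of unimodal profiles into
  continuous unimodal profiles. As the potential \<open>\<Phi>\<close> is convex, the energy lies above its tangents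
  (\<open>potential_energy_above_tangent\<close>), and together with the Cauchy--Schwarz inequality this gives an
  improvement principle: for a unit vector \<open>V\<close> of the cone at which the gradient of the energy does
  not vanish, the normalized gradient again is a unit vector of the cone, and its energy is not smaller
  (\<open>potential_energy_normalized_gradient\<close>). This one step does the work of weak compactness and of
  the calculus of variations. The normalized gradients of a maximizing sequence are still
  maximizing but uniformly Lipschitz, so Arzela--Ascoli yields a continuous maximizer
  (\<open>continuous_maximizer_exists\<close>). At a maximizer nothing is gained by the step, hence
  Cauchy--Schwarz is an equality and the gradient is a positive multiple of the maximizer
  (\<open>maximizer_gradient\<close>); this is the traveling wave equation, and the constraint of the cone
  contributes no multiplier. Derivatives follow from the fundamental theorem of calculus, and
  positivity because a zero would propagate (\<open>maximizer_positive\<close>).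

  In the limit \<open>\<delta> \<rightarrow> 0\<close> only the maximum of the averaged profile counts, since the force grows
  exponentially. A unit vector satisfies \<open>avg V 0 \<le> 1\<close>, with equality only for the indicator of
  the interval \<open>{-1/2..1/2}\<close>. In quantitative form, the squared distance to the indicator is
  \<open>2 - 2 * avg V 0\<close> (\<open>L2_distance_limit_velocity\<close>). Comparing the energy of a maximizer with that of
  the indicator forces \<open>avg V 0\<close> to tend to 1 (\<open>maximizer_avg_tendsto\<close>), and uniform convergence of
  the averages is inherited from convergence in \<open>L\<^sup>2\<close>.
\<close>

section \<open>Periodic square-integrable functions and their averages\<close>

lemma shift_into_period:
  fixes L x :: real
  assumes "0 < L"
  obtains m :: int where "x - of_int m * (2 * L) \<in> {-L..L}"
proof -
  define m where "m = \<lfloor>(x + L) / (2 * L)\<rfloor>"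
  have "of_int m \<le> (x + L) / (2 * L)" "(x + L) / (2 * L) < of_int m + 1"
    unfolding m_def by linarith+
  then have "x - of_int m * (2 * L) \<in> {-L..L}"
    using assms by (auto simp: field_simps)
  then show ?thesis by (rule that)
qed

lemma periodic_integrable_on:
  fixes f :: "real \<Rightarrow> real"
  assumes "L > 0" and per: "\<And>x. f (x + 2 * L) = f x" and int: "f integrable_on {-L..L}"
  shows "f integrable_on {a..b}"
proof -
  have shift: "f integrable_on {u + 2 * L..v + 2 * L} \<longleftrightarrow> f integrable_on {u..v}" for u v
    using integrable_shift_real_ivl_iff[of f "2 * L" "u + 2 * L" "v + 2 * L"] per by simp
  \<comment> \<open>Add one translated period on either side at a time.\<close>
  have *: "f integrable_on {-L - 2 * L * real n..L + 2 * L * real n}" for n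
  proof (induction n)
    case (Suc n)
    let ?u = "-L - 2 * L * real n" and ?v = "L + 2 * L * real n"
    have sh: "f integrable_on {?u + 2 * L..?v + 2 * L}" "f integrable_on {?u - 2 * L..?v - 2 * L}"
      using Suc shift[of ?u ?v] shift[of "?u - 2 * L" "?v - 2 * L"] by simp_all
    have nn: "0 \<le> L * real n" using \<open>L > 0\<close> by simp
    have "f integrable_on {?v..?v + 2 * L}"
      by (rule integrable_on_subinterval[OF sh(1)]) (use nn \<open>L > 0\<close> in auto)
    moreover have "f integrable_on {?u - 2 * L..?u}"
      by (rule integrable_on_subinterval[OF sh(2)]) (use nn \<open>L > 0\<close> in auto)
    ultimately have "f integrable_on {?u - 2 * L..?v + 2 * L}"
      using Suc nn \<open>L > 0\<close>
      by (intro Henstock_Kurzweil_Integration.integrable_combine[of "?u - 2 * L" ?v "?v + 2 * L"]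
            Henstock_Kurzweil_Integration.integrable_combine[of "?u - 2 * L" ?u ?v]) auto
    then show ?case
      by (simp add: algebra_simps)
  qed (use int in simp)
  obtain n where n: "max \<bar>a\<bar> \<bar>b\<bar> < real n * (2 * L)"
    using reals_Archimedean3[of "2 * L", THEN spec, of "max \<bar>a\<bar> \<bar>b\<bar>"] \<open>L > 0\<close> by fastforce
  have "{a..b} \<subseteq> {-L - 2 * L * real n..L + 2 * L * real n}"
    using n \<open>L > 0\<close> by (auto simp: algebra_simps)
  then show ?thesis
    using * integrable_on_subinterval by blast
qed

lemma periodic_integral_shift:
  fixes f :: "real \<Rightarrow> real"
  assumes "L > 0" and per: "\<And>x. f (x + 2 * L) = f x" and int: "\<And>a b. f integrable_on {a..b}"
  shows "integral {c - L..c + L} f = integral {-L..L} f"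
proof -
  have *: "integral {u..u + 2 * L} f = integral {v..v + 2 * L} f" if "u \<le> v" for u v
  proof -
    have "integral {u..v} f + integral {v..v + 2 * L} f = integral {u..v + 2 * L} f"
      using that \<open>L > 0\<close> int by (intro Henstock_Kurzweil_Integration.integral_combine) auto
    moreover have "integral {u..u + 2 * L} f + integral {u + 2 * L..v + 2 * L} f = integral {u..v + 2 * L} f"
      using that \<open>L > 0\<close> int by (intro Henstock_Kurzweil_Integration.integral_combine) auto
    moreover have "integral {u + 2 * L..v + 2 * L} f = integral {u..v} f"
      using integral_shift_real_ivl[of "u + 2 * L" "2 * L" "v + 2 * L" f] per by simp
    ultimately show ?thesis by linarith
  qed
  show ?thesis
    using *[of "c - L" "-L"] *[of "-L" "c - L"] by (cases "c - L \<le> -L") (simp_all add: algebra_simps)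
qed

text \<open>
  Integrability is required on every bounded interval, and measurability on the whole line, so
  that windows of averaging that leave the fundamental period need no special treatment.
\<close>

definition periodic_L2 :: "real \<Rightarrow> (real \<Rightarrow> real) \<Rightarrow> bool" where
  "periodic_L2 L V \<longleftrightarrow> (\<forall>x. V (x + 2 * L) = V x) \<and> V \<in> borel_measurable lebesgue
     \<and> (\<forall>a b. (\<lambda>x. (V x)\<^sup>2) integrable_on {a..b})"

lemma periodic_L2_absolutely_integrable_mult:
  assumes "periodic_L2 L V" "periodic_L2 L W"
  shows "(\<lambda>x. V x * W x) absolutely_integrable_on {a..b}"
proof (rule measurable_bounded_by_integrable_imp_absolutely_integrable)
  show "(\<lambda>x. V x * W x) \<in> borel_measurable (lebesgue_on {a..b})"
    using assms unfolding periodic_L2_def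
    by (intro borel_measurable_times measurable_restrict_space1) auto
  show "(\<lambda>x. (V x)\<^sup>2 + (W x)\<^sup>2) integrable_on {a..b}"
    using assms unfolding periodic_L2_def by (intro integrable_add) auto
  show "norm (V x * W x) \<le> (V x)\<^sup>2 + (W x)\<^sup>2" for x
  proof -
    have "0 \<le> \<bar>V x\<bar> * \<bar>W x\<bar>" by simp
    moreover have "2 * (\<bar>V x\<bar> * \<bar>W x\<bar>) \<le> (V x)\<^sup>2 + (W x)\<^sup>2"
      using sum_squares_bound[of "\<bar>V x\<bar>" "\<bar>W x\<bar>"] by simp
    ultimately show ?thesis
      unfolding real_norm_def abs_mult by linarith
  qed
qed auto

lemma periodic_L2_diff:
  assumes "periodic_L2 L V" "periodic_L2 L W"
  shows "periodic_L2 L (\<lambda>x. V x - c * W x)"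
proof -
  have "(\<lambda>x. (V x)\<^sup>2 - 2 * c * (V x * W x) + c\<^sup>2 * (W x)\<^sup>2) integrable_on {a..b}" for a b
    using assms set_lebesgue_integral_eq_integral(1)[OF periodic_L2_absolutely_integrable_mult[OF assms]]
    unfolding periodic_L2_def
    by (intro integrable_add integrable_diff integrable_on_mult_right) auto
  then have "(\<lambda>x. (V x - c * W x)\<^sup>2) integrable_on {a..b}" for a b
    by (simp add: power2_eq_square algebra_simps)
  then show ?thesis
    using assms unfolding periodic_L2_def
    by (intro conjI allI borel_measurable_diff borel_measurable_times borel_measurable_const) simp_all
qed

lemma periodic_L2_continuous:
  assumes "continuous_on UNIV W" "\<And>x. W (x + 2 * L) = W x"
  shows "periodic_L2 L W"
  unfolding periodic_L2_def
proof (intro conjI allI)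
  show "W \<in> borel_measurable lebesgue"
    using assms(1) by (simp add: borel_measurable_continuous_onI measurable_completion)
  show "(\<lambda>x. (W x)\<^sup>2) integrable_on {a..b}" for a b
    by (intro integrable_continuous_real continuous_intros continuous_on_subset[OF assms(1)]) auto
qed (use assms in auto)

lemma periodic_L2_absolutely_integrable:
  assumes "periodic_L2 L V"
  shows "V absolutely_integrable_on {a..b}"
  using periodic_L2_absolutely_integrable_mult[OF assms periodic_L2_continuous[of "\<lambda>x. 1"]] by simp

lemma periodic_L2_integrable:
  assumes "periodic_L2 L V"
  shows "V integrable_on {a..b}"
  using periodic_L2_absolutely_integrable[OF assms] set_lebesgue_integral_eq_integral(1) by blast

lemma L2_norm_on_eq:
  assumes "periodic_L2 L V"
  shows "L2_norm_on L V = sqrt (integral {-L..L} (\<lambda>x. (V x)\<^sup>2))"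
  unfolding L2_norm_on_def
  using set_lebesgue_integral_eq_integral(2)[OF periodic_L2_absolutely_integrable_mult[OF assms assms]]
  by (simp add: power2_eq_square)

lemma integral_power2_eq:
  assumes "periodic_L2 L V"
  shows "integral {-L..L} (\<lambda>x. (V x)\<^sup>2) = (L2_norm_on L V)\<^sup>2"
proof -
  have "0 \<le> integral {-L..L} (\<lambda>x. (V x)\<^sup>2)"
    by (rule integral_nonneg) (use assms in \<open>auto simp: periodic_L2_def\<close>)
  then show ?thesis by (simp add: L2_norm_on_eq[OF assms])
qed

lemma L2_norm_on_divide:
  assumes "periodic_L2 L G" "0 < L2_norm_on L G"
  shows "L2_norm_on L (\<lambda>x. G x / L2_norm_on L G) = 1"
proof -
  have "L2_norm_on L (\<lambda>x. G x / L2_norm_on L G) = sqrt ((LINT x:{-L..L}|lebesgue. (G x)\<^sup>2) / (L2_norm_on L G)\<^sup>2)"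
    unfolding L2_norm_on_def[of L "\<lambda>x. G x / L2_norm_on L G"] power_divide by simp
  also have "\<dots> = L2_norm_on L G / L2_norm_on L G"
    using assms(2) by (simp add: real_sqrt_divide) (simp add: L2_norm_on_def)
  finally show ?thesis using assms(2) by simp
qed

lemma integral_power2_diff:
  assumes "periodic_L2 L V" "periodic_L2 L W"
  shows "integral {a..b} (\<lambda>x. (V x - c * W x)\<^sup>2)
    = integral {a..b} (\<lambda>x. (V x)\<^sup>2) - 2 * c * integral {a..b} (\<lambda>x. V x * W x) + c\<^sup>2 * integral {a..b} (\<lambda>x. (W x)\<^sup>2)"
proof (rule integral_unique)
  have "(\<lambda>x. V x * W x) integrable_on {a..b}"
    using set_lebesgue_integral_eq_integral(1)[OF periodic_L2_absolutely_integrable_mult[OF assms]] .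
  then have "((\<lambda>x. (V x)\<^sup>2 - 2 * c * (V x * W x) + c\<^sup>2 * (W x)\<^sup>2) has_integral
      integral {a..b} (\<lambda>x. (V x)\<^sup>2) - 2 * c * integral {a..b} (\<lambda>x. V x * W x) + c\<^sup>2 * integral {a..b} (\<lambda>x. (W x)\<^sup>2)) {a..b}"
    using assms unfolding periodic_L2_def
    by (intro has_integral_add has_integral_diff has_integral_mult_right integrable_integral) auto
  moreover have "(\<lambda>x. (V x)\<^sup>2 - 2 * c * (V x * W x) + c\<^sup>2 * (W x)\<^sup>2) = (\<lambda>x. (V x - c * W x)\<^sup>2)"
    by (simp add: fun_eq_iff power2_eq_square algebra_simps)
  ultimately show "((\<lambda>x. (V x - c * W x)\<^sup>2) has_integral
      integral {a..b} (\<lambda>x. (V x)\<^sup>2) - 2 * c * integral {a..b} (\<lambda>x. V x * W x) + c\<^sup>2 * integral {a..b} (\<lambda>x. (W x)\<^sup>2)) {a..b}"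
    by simp
qed

lemma integral_Cauchy_Schwarz:
  assumes V: "periodic_L2 L V" and G: "periodic_L2 L G" and 1: "L2_norm_on L V = 1"
  shows "integral {-L..L} (\<lambda>x. G x * V x) \<le> L2_norm_on L G"
proof -
  let ?p = "integral {-L..L} (\<lambda>x. G x * V x)"
  have V1: "integral {-L..L} (\<lambda>x. (V x)\<^sup>2) = 1"
    using 1 by (simp add: L2_norm_on_eq[OF V])
  \<comment> \<open>The distance from \<open>G\<close> to its projection onto the unit vector \<open>V\<close>.\<close>
  have "0 \<le> integral {-L..L} (\<lambda>x. (G x - ?p * V x)\<^sup>2)"
    by (rule integral_nonneg) (use periodic_L2_diff[OF G V, of ?p] in \<open>auto simp: periodic_L2_def\<close>)
  then have "2 * (?p * ?p) \<le> integral {-L..L} (\<lambda>x. (G x)\<^sup>2) + ?p\<^sup>2"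
    unfolding integral_power2_diff[OF G V] V1 by simp
  then have "?p\<^sup>2 \<le> integral {-L..L} (\<lambda>x. (G x)\<^sup>2)"
    unfolding power2_eq_square[of ?p] by linarith
  then have "\<bar>?p\<bar> \<le> L2_norm_on L G"
    using real_sqrt_le_mono by (fastforce simp: L2_norm_on_eq[OF G])
  then show ?thesis by linarith
qed

lemma avg_eq_integral:
  assumes "periodic_L2 L V"
  shows "avg V x = integral {x - 1/2..x + 1/2} V"
  unfolding avg_def using set_lebesgue_integral_eq_integral(2)[OF periodic_L2_absolutely_integrable[OF assms]] .

lemma avg_eq_indefinite:
  assumes "periodic_L2 L V" "c \<le> x - 1/2"
  shows "avg V x = integral {c..x + 1/2} V - integral {c..x - 1/2} V"
proof -
  have "integral {c..x - 1/2} V + integral {x - 1/2..x + 1/2} V = integral {c..x + 1/2} V"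
    using assms(2) periodic_L2_integrable[OF assms(1)]
    by (intro Henstock_Kurzweil_Integration.integral_combine) simp_all
  then show ?thesis
    unfolding avg_eq_integral[OF assms(1)] by linarith
qed

lemma avg_increment:
  assumes "periodic_L2 L V" "x \<le> y"
  shows "avg V y - avg V x = integral {x + 1/2..y + 1/2} V - integral {x - 1/2..y - 1/2} V"
proof -
  have "avg V y = integral {x - 1/2..y + 1/2} V - integral {x - 1/2..y - 1/2} V"
    using assms by (intro avg_eq_indefinite[OF assms(1)]) auto
  moreover have "integral {x - 1/2..x + 1/2} V + integral {x + 1/2..y + 1/2} V = integral {x - 1/2..y + 1/2} V"
    using assms(2) periodic_L2_integrable[OF assms(1)]
    by (intro Henstock_Kurzweil_Integration.integral_combine) auto
  ultimately show ?thesis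
    unfolding avg_eq_integral[OF assms(1)] by linarith
qed

lemma avg_periodic:
  assumes "periodic_L2 L V"
  shows "avg V (x + 2 * L) = avg V x"
proof -
  have per: "V (x + 2 * L) = V x" for x using assms unfolding periodic_L2_def by auto
  show ?thesis
    unfolding avg_eq_integral[OF assms]
    using integral_shift_real_ivl[of "x + 2 * L - 1/2" "2 * L" "x + 2 * L + 1/2" V]
    unfolding per by (simp add: diff_right_commute)
qed

lemma avg_continuous:
  assumes "periodic_L2 L V"
  shows "continuous_on UNIV (avg V)"
proof -
  have "isCont (avg V) x" for x
  proof -
    define I where "I = (\<lambda>y. integral {x - 3..y} V)"
    have I: "continuous_on {x - 3..x + 3} I"
      unfolding I_def by (intro indefinite_integral_continuous_1 periodic_L2_integrable[OF assms])
    have c: "continuous_on {x - 1<..<x + 1} (\<lambda>y. I (y + 1/2) - I (y - 1/2))"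
      by (intro continuous_intros continuous_on_compose2[OF I]) auto
    have "I (y + 1/2) - I (y - 1/2) = avg V y" if "y \<in> {x - 1<..<x + 1}" for y
      unfolding I_def using avg_eq_indefinite[OF assms, of "x - 3" y] that by simp
    from continuous_on_eq[OF c this] have "continuous_on {x - 1<..<x + 1} (avg V)" .
    then show ?thesis
      by (simp add: continuous_on_eq_continuous_at)
  qed
  then show ?thesis by (simp add: continuous_on_eq_continuous_at)
qed

lemma avg_has_derivative:
  assumes "continuous_on UNIV V" "periodic_L2 L V"
  shows "(avg V has_real_derivative V (x + 1/2) - V (x - 1/2)) (at x)"
proof -
  define I where "I = (\<lambda>y. integral {x - 3..y} V)"
  have I: "(I has_real_derivative V y) (at y)" if "y \<in> {x - 2..x + 2}" for y
  proof -
    have "(I has_real_derivative V y) (at y within {x - 3..x + 3})"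
      unfolding I_def
    proof (rule integral_has_real_derivative)
      show "continuous_on {x - 3..x + 3} V"
        by (rule continuous_on_subset[OF assms(1)]) simp
    qed (use that in auto)
    moreover have "y \<in> interior {x - 3..x + 3}"
      using that by auto
    ultimately show ?thesis
      by (simp only: at_within_interior)
  qed
  have "((\<lambda>y. I (y + 1/2)) has_real_derivative V (x + 1/2)) (at x)"
    using I[of "x + 1/2"] DERIV_shift[of I "V (x + 1/2)" x "1/2"] by simp
  moreover have "((\<lambda>y. I (y + - (1/2))) has_real_derivative V (x - 1/2)) (at x)"
    using I[of "x - 1/2"] DERIV_shift[of I "V (x - 1/2)" x "- (1/2)"] by simp
  ultimately have "((\<lambda>y. I (y + 1/2) - I (y - 1/2)) has_real_derivative V (x + 1/2) - V (x - 1/2)) (at x)"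
    by (auto dest: DERIV_diff)
  moreover have "\<forall>\<^sub>F y in nhds x. I (y + 1/2) - I (y - 1/2) = avg V y"
  proof (rule eventually_nhds_in_open[of "{x - 1<..<x + 1}", THEN eventually_mono])
    show "I (y + 1/2) - I (y - 1/2) = avg V y" if "y \<in> {x - 1<..<x + 1}" for y
      unfolding I_def using avg_eq_indefinite[OF assms(2), of "x - 3" y] that by simp
  qed auto
  ultimately show ?thesis
    by (subst (asm) DERIV_cong_ev[OF refl _ refl])
qed

lemma avg_const: "avg (\<lambda>_. c) x = c"
  using avg_eq_integral[OF periodic_L2_continuous[of "\<lambda>_. c" 0]] by simp

lemma avg_diff:
  assumes "periodic_L2 L V" "periodic_L2 L W"
  shows "avg (\<lambda>x. V x - W x) x = avg V x - avg W x"
  using periodic_L2_diff[OF assms, of 1] assms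
  by (simp add: avg_eq_integral integral_diff periodic_L2_integrable)

lemma avg_le:
  assumes "periodic_L2 L V" "\<And>x. V x \<le> M"
  shows "avg V x \<le> M"
proof -
  have "integral {x - 1/2..x + 1/2} V \<le> integral {x - 1/2..x + 1/2} (\<lambda>_. M)"
    using assms(2) by (intro integral_le periodic_L2_integrable[OF assms(1)]) auto
  then show ?thesis by (simp add: avg_eq_integral[OF assms(1)])
qed

lemma avg_eq_0_imp:
  assumes "continuous_on UNIV V" "periodic_L2 L V" "\<And>x. 0 \<le> V x" "avg V x = 0" "\<bar>y - x\<bar> \<le> 1/2"
  shows "V y = 0"
proof -
  have "integral {x - 1/2..x + 1/2} V = 0"
    using assms by (simp add: avg_eq_integral)
  then have "\<forall>y\<in>{x - 1/2..x + 1/2}. V y = 0"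
    by (subst (asm) integral_eq_0_iff) (auto intro: continuous_on_subset[OF assms(1)] assms(3))
  moreover have "y \<in> {x - 1/2..x + 1/2}"
    using assms(5) unfolding atLeastAtMost_iff by linarith
  ultimately show ?thesis by blast
qed

text \<open>
  The two increments in \<open>avg_increment\<close> are both between 0 and \<open>M * \<bar>x - y\<bar>\<close>, so their difference
  does not cost a factor 2.
\<close>

lemma avg_Lipschitz:
  assumes V: "periodic_L2 L V" and M: "\<And>x. 0 \<le> V x" "\<And>x. V x \<le> M"
  shows "\<bar>avg V x - avg V y\<bar> \<le> M * \<bar>x - y\<bar>"
proof -
  have *: "\<bar>avg V x - avg V y\<bar> \<le> M * \<bar>x - y\<bar>" if "x \<le> y" for x y
  proof -
    have "0 \<le> integral {u..v} V" "integral {u..v} V \<le> M * (v - u)" if "u \<le> v" for u v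
    proof -
      show "0 \<le> integral {u..v} V"
        using M by (intro integral_nonneg periodic_L2_integrable[OF V]) auto
      have "integral {u..v} V \<le> integral {u..v} (\<lambda>_. M)"
        using M by (intro integral_le periodic_L2_integrable[OF V]) auto
      then show "integral {u..v} V \<le> M * (v - u)"
        using that by (simp add: mult.commute)
    qed
    from this[of "x + 1/2" "y + 1/2"] this[of "x - 1/2" "y - 1/2"] show ?thesis
      using avg_increment[OF V that] that by simp
  qed
  show ?thesis
    using *[of x y] *[of y x] by (cases "x \<le> y") (simp_all add: abs_minus_commute)
qed

text \<open>
  The variance of \<open>V\<close> over a window of length 1 is nonnegative, and the window fits into one
  period. With the square root taken, this bounds the uniform norm of an average by the \<open>L\<^sup>2\<close>
  norm.
\<close>

lemma avg_power2_le:
  assumes "1 \<le> 2 * L" and V: "periodic_L2 L V"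
  shows "(avg V x)\<^sup>2 \<le> integral {-L..L} (\<lambda>x. (V x)\<^sup>2)"
proof -
  let ?I = "{x - 1/2..x + 1/2}" and ?m = "avg V x"
  have sq: "(\<lambda>x. (V x)\<^sup>2) integrable_on {a..b}" for a b
    using V unfolding periodic_L2_def by auto
  have "0 \<le> integral ?I (\<lambda>y. (V y - ?m)\<^sup>2)"
    by (rule integral_nonneg)
      (use periodic_L2_diff[OF V, of "\<lambda>_. 1" ?m] periodic_L2_continuous[of "\<lambda>_. 1" L] in
        \<open>auto simp: periodic_L2_def\<close>)
  also have "\<dots> = integral ?I (\<lambda>y. (V y)\<^sup>2 - 2 * ?m * V y + ?m\<^sup>2)"
    by (rule integral_cong) (simp add: power2_eq_square algebra_simps)
  also have "\<dots> = integral ?I (\<lambda>y. (V y)\<^sup>2) - 2 * ?m * ?m + ?m\<^sup>2"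
  proof (rule integral_unique)
    have "((\<lambda>y. (V y)\<^sup>2) has_integral integral ?I (\<lambda>y. (V y)\<^sup>2)) ?I" "(V has_integral ?m) ?I"
      "((\<lambda>y. ?m\<^sup>2) has_integral ?m\<^sup>2) ?I"
      using sq periodic_L2_integrable[OF V] has_integral_const_real[of "?m\<^sup>2" "x - 1/2" "x + 1/2"]
      by (simp_all add: avg_eq_integral[OF V] integrable_integral)
    then show "((\<lambda>y. (V y)\<^sup>2 - 2 * ?m * V y + ?m\<^sup>2) has_integral
        integral ?I (\<lambda>y. (V y)\<^sup>2) - 2 * ?m * ?m + ?m\<^sup>2) ?I"
      by (intro has_integral_add has_integral_diff has_integral_mult_right)
  qed
  finally have "?m\<^sup>2 \<le> integral ?I (\<lambda>y. (V y)\<^sup>2)"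
    by (simp add: power2_eq_square)
  also have "\<dots> \<le> integral {x - L..x + L} (\<lambda>y. (V y)\<^sup>2)"
    using assms sq by (intro integral_subset_le) auto
  also have "\<dots> = integral {-L..L} (\<lambda>y. (V y)\<^sup>2)"
    using assms sq by (intro periodic_integral_shift) (auto simp: periodic_L2_def)
  finally show ?thesis .
qed

lemma avg_le_L2_norm:
  assumes "1 \<le> 2 * L" "periodic_L2 L V"
  shows "\<bar>avg V x\<bar> \<le> L2_norm_on L V"
proof -
  have "\<bar>avg V x\<bar> = sqrt ((avg V x)\<^sup>2)" by simp
  also have "\<dots> \<le> L2_norm_on L V"
    using avg_power2_le[OF assms] by (simp add: L2_norm_on_eq[OF assms(2)] del: real_sqrt_abs)
  finally show ?thesis .
qed

section \<open>Self-adjointness of averaging\<close>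

text \<open>
  In contrast to \<open>AE_borel_affine\<close>, the predicate may be nonmeasurable; the set of exceptions is
  enclosed in a Borel null set.
\<close>

lemma AE_lborel_affine:
  fixes P :: "real \<Rightarrow> bool"
  assumes "AE x in lborel. P x" and "c \<noteq> 0"
  shows "AE x in lborel. P (t + c * x)"
proof -
  obtain N where N: "N \<in> null_sets lborel" "{x. \<not> P x} \<subseteq> N"
    using assms(1) unfolding eventually_ae_filter by auto
  have "AE x in lborel. t + c * x \<notin> N"
    using N(1) AE_not_in[OF N(1)] by (intro AE_borel_affine[OF \<open>c \<noteq> 0\<close>]) (auto simp: null_sets_def)
  then show ?thesis
    by (rule AE_mp) (use N(2) in auto)
qed

text \<open>
  Connects a Lebesgue integral over the line with a gauge integral over an interval; no
  measurability of \<open>g\<close> has to be checked, which matters when \<open>g\<close> is itself an integral.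
\<close>

lemma lborel_integral_eq_integral_AE:
  fixes g H :: "real \<Rightarrow> real"
  assumes "integrable lborel H" and "AE x in lborel. H x = indicat_real {a..b} x * g x"
  shows "(LINT x|lborel. H x) = integral {a..b} g"
proof -
  obtain N where N: "negligible N" "{x. H x \<noteq> indicat_real {a..b} x * g x} \<subseteq> N"
    using AE_completion[OF assms(2)] unfolding eventually_ae_filter_negligible by auto
  have "(LINT x|lborel. H x) = integral UNIV H"
    using has_integral_integral_lborel[OF assms(1)] by (simp add: integral_unique)
  also have "\<dots> = integral UNIV (\<lambda>x. if x \<in> {a..b} then g x else 0)"
  proof (rule integral_spike[OF N(1)])
    show "(if x \<in> {a..b} then g x else 0) = H x" if "x \<in> UNIV - N" for x
    proof -
      have "H x = indicat_real {a..b} x * g x" using N(2) that by blast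
      then show ?thesis by simp
    qed
  qed
  also have "\<dots> = integral {a..b} g"
    by (rule integral_restrict_UNIV)
  finally show ?thesis .
qed

text \<open>
  Fubini's theorem for two shapes at once: \<open>(p, q) = (0, 1)\<close> averages \<open>V\<close>, and
  \<open>(p, q) = (-1, 0)\<close> averages \<open>f\<close>. A translation by \<open>s\<close> of the inner integral carries one into the
  other.
\<close>

lemma integral_swap_kernel:
  fixes f V :: "real \<Rightarrow> real"
  assumes f: "continuous_on UNIV f" "\<And>x. \<bar>f x\<bar> \<le> M" and V: "periodic_L2 L V" and q: "\<bar>q\<bar> \<le> 1"
  shows "integral {a..b} (\<lambda>x. integral {-1/2..1/2} (\<lambda>s. f (x + p * s) * V (x + q * s)))
       = integral {-1/2..1/2} (\<lambda>s. integral {a..b} (\<lambda>x. f (x + p * s) * V (x + q * s)))"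
proof -
  have "V \<in> borel_measurable lebesgue"
    using V unfolding periodic_L2_def by auto
  then obtain U where U[measurable]: "U \<in> borel_measurable lborel" and VU: "AE x in lborel. V x = U x"
    using completion_ex_borel_measurable_real by blast
  have [measurable]: "f \<in> borel_measurable borel"
    using f(1) by (simp add: borel_measurable_continuous_onI)
  \<comment> \<open>The product \<open>lborel \<Otimes>\<^sub>M lborel\<close> sees only Borel functions, hence \<open>U\<close> in place of \<open>V\<close>.\<close>
  define k where "k = (\<lambda>s x. indicat_real {-1/2..1/2} s * indicat_real {a..b} x * (f (x + p * s) * U (x + q * s)))"
  have k_meas [measurable]: "case_prod k \<in> borel_measurable (lborel \<Otimes>\<^sub>M lborel)"
    unfolding k_def by measurable
  define B where "B = M * integral {a - 1..b + 1} (\<lambda>x. \<bar>V x\<bar>)"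
  have shiftU: "AE x in lborel. V (x + c) = U (x + c)" for c
    using AE_lborel_affine[OF VU, of 1 c] by (simp add: add.commute)
  have absV: "(\<lambda>x. \<bar>V x\<bar>) integrable_on {u..v}" for u v
    using periodic_L2_absolutely_integrable[OF V] by (simp add: absolutely_integrable_on_def)
  have M: "0 \<le> M" using f(2)[of 0] by linarith
  have intU: "integrable lborel (\<lambda>x. indicat_real {u..v} x * U x)" for u v
  proof -
    have "integrable lebesgue (\<lambda>x. indicat_real {u..v} x * V x)"
      using periodic_L2_absolutely_integrable[OF V, of u v] unfolding set_integrable_def by simp
    moreover have "(\<lambda>x. indicat_real {u..v} x * U x) \<in> borel_measurable lebesgue"
      by (intro measurable_completion) measurable
    ultimately have "integrable lebesgue (\<lambda>x. indicat_real {u..v} x * U x)"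
      by (rule integrable_cong_AE_imp) (use AE_completion[OF VU] in eventually_elim, simp)
    then show ?thesis
      by (subst (asm) integrable_completion) measurable
  qed
  have intk: "integrable lborel (k s)" for s
  proof -
    have "integrable lborel (\<lambda>x. indicat_real {a + q * s..b + q * s} (q * s + 1 * x) * U (q * s + 1 * x))"
      by (rule lborel_integrable_real_affine[OF intU]) simp
    then have "integrable lborel (\<lambda>x. M * (indicat_real {a..b} x * U (x + q * s)))"
      by (simp add: indicator_def algebra_simps)
    then show ?thesis
    proof (rule Bochner_Integration.integrable_bound)
      show "AE x in lborel. norm (k s x) \<le> norm (M * (indicat_real {a..b} x * U (x + q * s)))"
        using f(2) M by (auto simp: k_def indicator_def abs_mult intro!: mult_right_mono)
    qed (unfold k_def, measurable)
  qed
  have bound: "(LINT x|lborel. norm (k s x)) \<le> indicat_real {-1/2..1/2} s * B" for s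
  proof (cases "s \<in> {-1/2..1/2}")
    case True
    have qs: "\<bar>q * s\<bar> \<le> 1"
    proof -
      have "\<bar>q\<bar> * \<bar>s\<bar> \<le> 1 * 1" using q True by (intro mult_mono) auto
      then show ?thesis by (simp add: abs_mult)
    qed
    have "(LINT x|lborel. norm (k s x)) = integral {a..b} (\<lambda>x. \<bar>f (x + p * s)\<bar> * \<bar>V (x + q * s)\<bar>)"
    proof (rule lborel_integral_eq_integral_AE)
      show "integrable lborel (\<lambda>x. norm (k s x))"
        by (rule integrable_norm[OF intk])
      show "AE x in lborel. norm (k s x) = indicat_real {a..b} x * (\<bar>f (x + p * s)\<bar> * \<bar>V (x + q * s)\<bar>)"
        by (rule eventually_mono[OF shiftU[of "q * s"]]) (use True in \<open>simp add: k_def abs_mult\<close>)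
    qed
    also have "\<dots> = integral {a + q * s..b + q * s} (\<lambda>y. \<bar>f (y - q * s + p * s)\<bar> * \<bar>V y\<bar>)"
      using integral_shift_real_ivl[of "a + q * s" "q * s" "b + q * s"
          "\<lambda>y. \<bar>f (y - q * s + p * s)\<bar> * \<bar>V y\<bar>"] by simp
    also have "\<dots> \<le> integral {a + q * s..b + q * s} (\<lambda>y. M * \<bar>V y\<bar>)"
    proof (rule integral_le)
      have "(\<lambda>y. \<bar>f (y - q * s + p * s)\<bar> * \<bar>V y\<bar>) absolutely_integrable_on {a + q * s..b + q * s}"
      proof (rule absolutely_integrable_bounded_measurable_product_real)
        show "(\<lambda>y. \<bar>f (y - q * s + p * s)\<bar>) \<in> borel_measurable (lebesgue_on {a + q * s..b + q * s})"
          by (intro measurable_restrict_space1 measurable_completion) measurable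
        show "bounded ((\<lambda>y. \<bar>f (y - q * s + p * s)\<bar>) ` {a + q * s..b + q * s})"
          unfolding bounded_iff using f(2) by (intro exI[of _ M]) auto
        show "(\<lambda>y. \<bar>V y\<bar>) absolutely_integrable_on {a + q * s..b + q * s}"
          using absV by (simp add: absolutely_integrable_on_def)
      qed auto
      then show "(\<lambda>y. \<bar>f (y - q * s + p * s)\<bar> * \<bar>V y\<bar>) integrable_on {a + q * s..b + q * s}"
        by (rule set_lebesgue_integral_eq_integral(1))
      show "(\<lambda>y. M * \<bar>V y\<bar>) integrable_on {a + q * s..b + q * s}"
        by (intro integrable_on_mult_right absV)
    qed (use f(2) in \<open>auto intro: mult_right_mono\<close>)
    also have "\<dots> = M * integral {a + q * s..b + q * s} (\<lambda>y. \<bar>V y\<bar>)"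
      by simp
    also have "\<dots> \<le> B"
      unfolding B_def by (intro mult_left_mono M integral_subset_le absV) (use qs in auto)
    finally show ?thesis using True by simp
  qed (simp add: k_def)
  have int: "integrable (lborel \<Otimes>\<^sub>M lborel) (case_prod k)"
  proof (rule lborel_pair.Fubini_integrable)
    have "integrable lborel (\<lambda>s::real. indicat_real {-1/2..1/2} s * B)"
      by (intro integrable_mult_left integrable_real_indicator) simp_all
    then show "integrable lborel (\<lambda>s. LINT x|lborel. norm (case_prod k (s, x)))"
    proof (rule Bochner_Integration.integrable_bound)
      show "AE s in lborel. norm (LINT x|lborel. norm (case_prod k (s, x))) \<le> norm (indicat_real {-1/2..1/2} s * B)"
      proof (intro AE_I2)
        fix s
        have "0 \<le> (LINT x|lborel. norm (k s x))" by simp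
        then show "norm (LINT x|lborel. norm (case_prod k (s, x))) \<le> norm (indicat_real {-1/2..1/2} s * B)"
          using bound[of s] by simp
      qed
    qed measurable
  qed (use intk in auto)
  have "(LINT x|lborel. LINT s|lborel. k s x) = integral {a..b} (\<lambda>x. integral {-1/2..1/2} (\<lambda>s. f (x + p * s) * V (x + q * s)))"
  proof (rule lborel_integral_eq_integral_AE)
    show "integrable lborel (\<lambda>x. LINT s|lborel. k s x)"
      using lborel_pair.integrable_snd[OF int] by simp
    \<comment> \<open>For \<open>q = 0\<close> the exceptional set consists of points \<open>x\<close>, otherwise of points \<open>s\<close> for each \<open>x\<close>.\<close>
    have "AE x in lborel. AE s in lborel. V (x + q * s) = U (x + q * s)"
    proof (cases "q = 0")
      case True
      then show ?thesis using VU by (auto elim!: eventually_mono)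
    next
      case False
      show ?thesis
        using AE_lborel_affine[OF VU False] by auto
    qed
    with lborel_pair.AE_integrable_snd[OF int]
    show "AE x in lborel. (LINT s|lborel. k s x)
        = indicat_real {a..b} x * integral {-1/2..1/2} (\<lambda>s. f (x + p * s) * V (x + q * s))"
    proof eventually_elim
      case (elim x)
      have "(LINT s|lborel. k s x) = integral {-1/2..1/2} (\<lambda>s. indicat_real {a..b} x * (f (x + p * s) * V (x + q * s)))"
        by (rule lborel_integral_eq_integral_AE) (use elim in \<open>auto elim!: eventually_mono simp: k_def\<close>)
      then show ?case by simp
    qed
  qed
  moreover have "(LINT s|lborel. LINT x|lborel. k s x) = integral {-1/2..1/2} (\<lambda>s. integral {a..b} (\<lambda>x. f (x + p * s) * V (x + q * s)))"
  proof (rule lborel_integral_eq_integral_AE)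
    show "integrable lborel (\<lambda>s. LINT x|lborel. k s x)"
      using lborel_pair.integrable_fst[OF int] by simp
    show "AE s in lborel. (LINT x|lborel. k s x)
        = indicat_real {-1/2..1/2} s * integral {a..b} (\<lambda>x. f (x + p * s) * V (x + q * s))"
    proof (intro AE_I2)
      fix s
      have "(LINT x|lborel. k s x) = integral {a..b} (\<lambda>x. indicat_real {-1/2..1/2} s * (f (x + p * s) * V (x + q * s)))"
        by (rule lborel_integral_eq_integral_AE[OF intk], use shiftU[of "q * s"] in eventually_elim) (simp add: k_def)
      then show "(LINT x|lborel. k s x) = indicat_real {-1/2..1/2} s * integral {a..b} (\<lambda>x. f (x + p * s) * V (x + q * s))"
        by simp
    qed
  qed
  ultimately show ?thesis
    using lborel_pair.Fubini_integral[OF int] by simp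
qed

lemma avg_eq_integral_shift:
  assumes "periodic_L2 L V"
  shows "avg V x = integral {-1/2..1/2} (\<lambda>s. V (x + s))" "avg V x = integral {-1/2..1/2} (\<lambda>s. V (x - s))"
proof -
  show 1: "avg V x = integral {-1/2..1/2} (\<lambda>s. V (x + s))"
    using integral_shift_real_ivl[of "x - 1/2" x "x + 1/2" V] unfolding avg_eq_integral[OF assms]
    by (simp add: add.commute)
  show "avg V x = integral {-1/2..1/2} (\<lambda>s. V (x - s))"
    unfolding 1 using Henstock_Kurzweil_Integration.integral_reflect_real[of "1/2" "-1/2" "\<lambda>s. V (x + s)"] by simp
qed

lemma continuous_periodic_bounded:
  fixes f :: "real \<Rightarrow> real"
  assumes "L > 0" "continuous_on UNIV f" "\<And>x. f (x + 2 * L) = f x"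
  shows "\<exists>M. \<forall>x. \<bar>f x\<bar> \<le> M"
proof -
  interpret periodic_fun_simple f "2 * L" by standard (use assms in auto)
  have "bounded (f ` {-L..L})"
    by (intro compact_imp_bounded compact_continuous_image continuous_on_subset[OF assms(2)]) auto
  then obtain M where M: "\<And>x. x \<in> {-L..L} \<Longrightarrow> \<bar>f x\<bar> \<le> M"
    unfolding bounded_iff by (metis imageI real_norm_def)
  have "\<bar>f x\<bar> \<le> M" for x
  proof -
    obtain k :: int where "x - of_int k * (2 * L) \<in> {-L..L}"
      using shift_into_period[OF \<open>L > 0\<close>] by blast
    from M[OF this] show ?thesis by (simp add: minus_of_int)
  qed
  then show ?thesis by blast
qed

text \<open>
  The averaging kernel is symmetric, and the integral over a period is translation invariant.
\<close>

lemma avg_self_adjoint: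
  assumes "L > 0" and f: "continuous_on UNIV f" "\<And>x. f (x + 2 * L) = f x" and V: "periodic_L2 L V"
  shows "integral {-L..L} (\<lambda>x. f x * avg V x) = integral {-L..L} (\<lambda>x. avg f x * V x)"
proof -
  obtain M where M: "\<And>x. \<bar>f x\<bar> \<le> M"
    using continuous_periodic_bounded[OF \<open>L > 0\<close> f] by blast
  have per: "V (x + 2 * L) = V x" for x
    using V unfolding periodic_L2_def by auto
  have "integral {-L..L} (\<lambda>x. f x * avg V x) = integral {-L..L} (\<lambda>x. integral {-1/2..1/2} (\<lambda>s. f (x + 0 * s) * V (x + 1 * s)))"
    by (simp add: avg_eq_integral_shift(1)[OF V])
  also have "\<dots> = integral {-1/2..1/2} (\<lambda>s. integral {-L..L} (\<lambda>x. f (x + 0 * s) * V (x + 1 * s)))"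
    by (rule integral_swap_kernel[OF f(1) M V]) simp
  also have "\<dots> = integral {-1/2..1/2} (\<lambda>s. integral {-L..L} (\<lambda>x. f (x + (-1) * s) * V (x + 0 * s)))"
  proof (rule integral_cong)
    fix s
    let ?h = "\<lambda>y. f (y - s) * V y"
    have cs: "continuous_on UNIV (\<lambda>y. f (y - s))" 
      by (intro continuous_on_compose2[OF f(1)] continuous_intros) auto
    have ps: "f (y + 2 * L - s) = f (y - s)" for y
      using f(2)[of "y - s"] by (simp add: algebra_simps)
    have "?h absolutely_integrable_on {u..v}" for u v
      using periodic_L2_absolutely_integrable_mult[OF periodic_L2_continuous[OF cs ps] V] .
    then have int: "?h integrable_on {u..v}" for u v
      using set_lebesgue_integral_eq_integral(1) by blast
    have "integral {-L..L} (\<lambda>x. f x * V (x + s)) = integral {s - L..s + L} ?h"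
      using integral_shift_real_ivl[of "s - L" s "s + L" ?h] by simp
    also have "\<dots> = integral {-L..L} ?h"
      by (rule periodic_integral_shift[OF \<open>L > 0\<close>]) (use ps per int in auto)
    finally show "integral {-L..L} (\<lambda>x. f (x + 0 * s) * V (x + 1 * s)) = integral {-L..L} (\<lambda>x. f (x + (-1) * s) * V (x + 0 * s))"
      by simp
  qed
  also have "\<dots> = integral {-L..L} (\<lambda>x. integral {-1/2..1/2} (\<lambda>s. f (x + (-1) * s) * V (x + 0 * s)))"
    by (rule integral_swap_kernel[OF f(1) M V, symmetric]) simp
  also have "\<dots> = integral {-L..L} (\<lambda>x. avg f x * V x)"
    by (simp add: avg_eq_integral_shift(2)[OF periodic_L2_continuous[OF f]])
  finally show ?thesis .
qed

section \<open>Unimodal profiles\<close>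

lemma profile_cone_periodic_L2:
  assumes "L > 0" "V \<in> profile_cone L"
  shows "periodic_L2 L V"
proof -
  have per: "V (x + 2 * L) = V x" for x
    using assms(2) unfolding profile_cone_def periodic_fun_simple_def by auto
  have meas: "V \<in> borel_measurable (lebesgue_on {-L..L})"
    using assms(2) unfolding profile_cone_def set_borel_measurable_def
    by (auto simp: borel_measurable_restrict_space_iff)
  have sq: "(\<lambda>x. (V x)\<^sup>2) integrable_on {-L..L}"
    using assms(2) set_lebesgue_integral_eq_integral(1) unfolding profile_cone_def by blast
  have "V absolutely_integrable_on {-L..L}"
  proof (rule measurable_bounded_by_integrable_imp_absolutely_integrable[OF meas])
    show "(\<lambda>x. 1 + (V x)\<^sup>2) integrable_on {-L..L}"
      using sq by (intro integrable_add) auto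
    show "norm (V x) \<le> 1 + (V x)\<^sup>2" for x
    proof -
      have "2 * \<bar>V x\<bar> \<le> 1 + (V x)\<^sup>2"
        using sum_squares_bound[of 1 "\<bar>V x\<bar>"] by simp
      then show ?thesis
        unfolding real_norm_def by linarith
    qed
  qed auto
  then have "V absolutely_integrable_on {a..b}" for a b
    using periodic_integrable_on[of L V] periodic_integrable_on[of L "\<lambda>x. norm (V x)"] per \<open>L > 0\<close>
    by (simp add: absolutely_integrable_on_def)
  then have m: "(\<lambda>x. indicat_real {-real n..real n} x *\<^sub>R V x) \<in> borel_measurable lebesgue" for n
    unfolding set_integrable_def by blast
  have "V \<in> borel_measurable lebesgue"
  proof (rule borel_measurable_LIMSEQ_real[OF _ m])
    fix x :: real
    obtain N where "\<bar>x\<bar> \<le> real N" using real_arch_simple by blast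
    then have "\<forall>\<^sub>F n in sequentially. indicat_real {-real n..real n} x *\<^sub>R V x = V x"
      by (intro eventually_sequentiallyI[of N]) (auto simp: indicator_def)
    then show "(\<lambda>n. indicat_real {-real n..real n} x *\<^sub>R V x) \<longlonglongrightarrow> V x"
      by (rule tendsto_eventually)
  qed
  then show ?thesis
    using per periodic_integrable_on[of L "\<lambda>x. (V x)\<^sup>2", OF \<open>L > 0\<close> _ sq]
    unfolding periodic_L2_def by auto
qed

text \<open>
  The conditions of the cone, imposed at every point of a continuous function. Averages of
  arbitrary elements of the cone have this form, so null sets can be forgotten after one averaging.
\<close>

definition continuous_profile :: "real \<Rightarrow> (real \<Rightarrow> real) \<Rightarrow> bool" where
  "continuous_profile L W \<longleftrightarrow> continuous_on UNIV W \<and> (\<forall>x. W (x + 2 * L) = W x) \<and> (\<forall>x. W (- x) = W x)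
     \<and> (\<forall>x y. 0 \<le> x \<longrightarrow> x \<le> y \<longrightarrow> y \<le> L \<longrightarrow> W y \<le> W x) \<and> (\<forall>x. 0 \<le> W x)"

lemma continuous_profileD:
  assumes "continuous_profile L W"
  shows "continuous_on UNIV W" "W (x + 2 * L) = W x" "W (- x) = W x"
    "0 \<le> x \<Longrightarrow> x \<le> y \<Longrightarrow> y \<le> L \<Longrightarrow> W y \<le> W x" "0 \<le> W x"
  using assms unfolding continuous_profile_def by auto

lemma continuous_profile_periodic_L2: "continuous_profile L W \<Longrightarrow> periodic_L2 L W"
  unfolding continuous_profile_def by (intro periodic_L2_continuous) auto

lemma continuous_profile_in_cone:
  assumes "continuous_profile L W"
  shows "W \<in> profile_cone L"
proof -
  have "W \<in> borel_measurable lebesgue"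
    using continuous_profile_periodic_L2[OF assms] unfolding periodic_L2_def by simp
  then have "set_borel_measurable lebesgue {-L..L} W"
    unfolding set_borel_measurable_def by (intro borel_measurable_scaleR borel_measurable_indicator) auto
  moreover have "set_integrable lebesgue {-L..L} (\<lambda>x. (W x)\<^sup>2)"
    using periodic_L2_absolutely_integrable_mult[of L W W] continuous_profile_periodic_L2[OF assms]
    by (simp add: power2_eq_square)
  ultimately show ?thesis
    using assms unfolding profile_cone_def continuous_profile_def periodic_fun_simple_def by auto
qed

lemma continuous_profile_const: "0 \<le> c \<Longrightarrow> continuous_profile L (\<lambda>_. c)"
  unfolding continuous_profile_def by auto

lemma continuous_profile_compose:
  fixes F :: "real \<Rightarrow> real"
  assumes W: "continuous_profile L W" and F: "continuous_on {0..} F"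
    and mono: "\<And>r s. 0 \<le> r \<Longrightarrow> r \<le> s \<Longrightarrow> F r \<le> F s" and nonneg: "\<And>r. 0 \<le> r \<Longrightarrow> 0 \<le> F r"
  shows "continuous_profile L (\<lambda>x. F (W x))"
  unfolding continuous_profile_def
proof (intro conjI allI impI)
  show "continuous_on UNIV (\<lambda>x. F (W x))"
    by (rule continuous_on_compose2[OF F continuous_profileD(1)[OF W]]) (use continuous_profileD(5)[OF W] in auto)
qed (simp_all add: continuous_profileD[OF W] mono nonneg)

lemma continuous_profile_divide:
  assumes "continuous_profile L W" "0 \<le> c"
  shows "continuous_profile L (\<lambda>x. W x / c)"
proof -
  have "continuous_on UNIV (\<lambda>x. W x * inverse c)"
    using assms unfolding continuous_profile_def by (intro continuous_intros) auto
  then show ?thesis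
    using assms unfolding continuous_profile_def by (auto intro!: divide_right_mono simp flip: divide_inverse)
qed

lemma AE_lborel_const:
  fixes a b :: real
  assumes "a < b" and "AE y in lborel. a < y \<and> y < b \<longrightarrow> R"
  shows R
proof (rule ccontr)
  assume "\<not> R"
  then have "AE y in lborel. y \<notin> {a<..<b}"
    using assms(2) by auto
  then have "{a<..<b} \<in> null_sets lborel"
    by (subst AE_iff_null_sets) auto
  then show False
    using \<open>a < b\<close> by (auto simp: null_sets_def)
qed

lemma profile_cone_AE:
  assumes "V \<in> profile_cone L"
  shows "AE x in lborel. AE y in lborel. 0 \<le> x \<and> x \<le> y \<and> y \<le> L \<longrightarrow> V (- x) = V x \<and> V y \<le> V x \<and> 0 \<le> V y"
proof -
  have "AE z in (lborel :: (real \<times> real) measure). case z of (x, y) \<Rightarrow>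
      0 \<le> x \<and> x \<le> y \<and> y \<le> L \<longrightarrow> V (- x) = V x \<and> V y \<le> V x \<and> 0 \<le> V y"
    using assms unfolding profile_cone_def AE_completion_iff by auto
  then show ?thesis
    unfolding lborel_prod[symmetric] by (drule_tac lborel_pair.AE_pair) simp
qed

lemma profile_cone_AE_even_nonneg:
  assumes "L > 0" and V: "V \<in> profile_cone L"
  shows "AE x in lborel. V (- x) = V x \<and> 0 \<le> V x"
proof -
  define Q where "Q = (\<lambda>x. V (- x) = V x \<and> 0 \<le> V x)"
  interpret periodic_fun_simple V "2 * L"
    using V unfolding profile_cone_def by auto
  have pos: "AE x in lborel. 0 < x \<and> x < L \<longrightarrow> Q x"
    using profile_cone_AE[OF V]
  proof (rule eventually_mono, intro impI)
    fix x assume *: "AE y in lborel. 0 \<le> x \<and> x \<le> y \<and> y \<le> L \<longrightarrow> V (- x) = V x \<and> V y \<le> V x \<and> 0 \<le> V y"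
      and x: "0 < x \<and> x < L"
    \<comment> \<open>\<open>Q x\<close> does not involve \<open>y\<close>, so almost every \<open>y\<close> in \<open>(x, L)\<close> is a witness.\<close>
    show "Q x"
      by (rule AE_lborel_const[of x L]) (use x in simp, rule eventually_mono[OF *], use x in \<open>auto simp: Q_def\<close>)
  qed
  have neg: "AE x in lborel. -L < x \<and> x < 0 \<longrightarrow> Q x"
  proof -
    have "AE x in lborel. 0 < - x \<and> - x < L \<longrightarrow> Q (- x)"
      using AE_lborel_affine[OF pos, of "-1" 0] by simp
    then show ?thesis
      by eventually_elim (auto simp: Q_def)
  qed
  \<comment> \<open>From one period to the line: the translates of the open period miss only multiples of \<open>L\<close>.\<close>
  have base: "AE x in lborel. -L < x \<and> x < L \<and> x \<noteq> 0 \<longrightarrow> Q x"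
    using pos neg by eventually_elim (auto simp: linorder_neq_iff)
  have "AE x in lborel. -L < x - of_int k * (2 * L) \<and> x - of_int k * (2 * L) < L
      \<and> x - of_int k * (2 * L) \<noteq> 0 \<longrightarrow> Q x" for k :: int
  proof -
    have "Q (x - of_int k * (2 * L)) \<longleftrightarrow> Q x" for x
      using plus_of_int[of "- x" k] by (simp add: Q_def minus_of_int)
    then show ?thesis
      using AE_lborel_affine[OF base, of 1 "- of_int k * (2 * L)"] by simp
  qed
  then have all: "AE x in lborel. \<forall>k::int. -L < x - of_int k * (2 * L) \<and> x - of_int k * (2 * L) < L
      \<and> x - of_int k * (2 * L) \<noteq> 0 \<longrightarrow> Q x"
    by (subst AE_all_countable) simp
  have "AE x in lborel. x \<notin> range (\<lambda>k::int. of_int k * L)"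
    by (intro AE_not_in countable_imp_null_set_lborel) simp
  with all have "AE x in lborel. Q x"
  proof eventually_elim
    case (elim x)
    obtain k :: int where "x - of_int k * (2 * L) \<in> {-L..L}"
      using shift_into_period[OF \<open>L > 0\<close>] by blast
    moreover have "x \<noteq> of_int (2 * k + 1) * L"
      using elim(2) by blast
    moreover have "x \<noteq> of_int (2 * k) * L" "x \<noteq> of_int (2 * k - 1) * L"
      using elim(2) by blast+
    ultimately show "Q x"
      using elim(1) by (auto simp: algebra_simps)
  qed
  then show ?thesis unfolding Q_def .
qed

text \<open>
  On the circle of length \<open>2 * L\<close>, the conditions on \<open>t\<close> say that \<open>s\<close> is at least as close to 0
  as \<open>t\<close> is. This is the form of unimodality that survives averaging.
\<close>

lemma profile_cone_AE_decreasing: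
  assumes "L > 0" and V: "V \<in> profile_cone L"
  shows "AE s in lborel. AE t in lborel. \<bar>s\<bar> \<le> t \<and> \<bar>s\<bar> \<le> 2 * L - t \<longrightarrow> V t \<le> V s"
proof -
  interpret periodic_fun_simple V "2 * L"
    using V unfolding profile_cone_def by auto
  define P where "P = (\<lambda>x y. 0 \<le> x \<and> x \<le> y \<and> y \<le> L \<longrightarrow> V y \<le> V x)"
  note Q = profile_cone_AE_even_nonneg[OF assms]
  \<comment> \<open>Fold \<open>s\<close> to \<open>\<bar>s\<bar>\<close> and \<open>t\<close> to \<open>min t (2 * L - t)\<close>; each of the four sign patterns is a
     reflection of the condition that defines the cone.\<close>
  have 1: "AE s in lborel. AE t in lborel. P s t"
    using profile_cone_AE[OF V]
    by (rule eventually_mono) (erule eventually_mono, simp add: P_def)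
  have refl: "AE s in lborel. AE t in lborel. P s (2 * L - t)" 
    using 1
  proof (rule eventually_mono)
    fix s assume "AE t in lborel. P s t"
    from AE_lborel_affine[OF this, of "-1" "2 * L"] show "AE t in lborel. P s (2 * L - t)"
      by simp
  qed
  have 2: "AE s in lborel. AE t in lborel. P (- s) t"
    using AE_lborel_affine[OF 1, of "-1" 0] by simp
  have 3: "AE s in lborel. AE t in lborel. P (- s) (2 * L - t)"
    using AE_lborel_affine[OF refl, of "-1" 0] by simp
  show ?thesis
    using 1 2 3 refl Q
  proof eventually_elim
    case (elim s)
    show ?case
      using elim(1-4) Q
    proof eventually_elim
      case (elim t)
      have "V (2 * L - t) = V t"
        using plus_period[of "- t"] elim(5) by (simp add: algebra_simps)
      then show ?case
        using elim(1-4) \<open>V (- s) = V s \<and> 0 \<le> V s\<close> unfolding P_def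
        by (cases "0 \<le> s"; cases "t \<le> L") auto
    qed
  qed
qed

text \<open>
  The derivative of \<open>avg V\<close> at \<open>x\<close> would be \<open>V (x + 1/2) - V (x - 1/2)\<close>, which unimodality makes
  nonpositive. But the pairs \<open>(x - 1/2, x + 1/2)\<close> form a line, which is a null set of the plane,
  so the comparison is instead integrated over a rectangle of pairs.
\<close>

lemma avg_decreasing_step:
  assumes "1 \<le> L" and V: "V \<in> profile_cone L" and "0 \<le> x" "x < y" "y \<le> L" "y - x \<le> 1"
  shows "avg V y \<le> avg V x"
proof -
  have L: "L > 0" using assms by simp
  note PV = profile_cone_periodic_L2[OF L V]
  note int = periodic_L2_absolutely_integrable[OF PV]
  let ?I = "{x - 1/2..y - 1/2}" and ?J = "{x + 1/2..y + 1/2}" and ?h = "y - x"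
  have eq: "(LINT s:{a..b}|lebesgue. V s) = integral {a..b} V" for a b
    by (rule set_lebesgue_integral_eq_integral(2)[OF int])
  have const: "(LINT s:{a..b}|lebesgue. c) = (b - a) * c" if "a \<le> b" for a b c :: real
    using that by (simp add: set_lebesgue_integral_eq_integral(2))
  \<comment> \<open>Every pair in \<open>?I \<times> ?J\<close> is ordered because \<open>y - x \<le> 1\<close>. Integrating first over \<open>?J\<close> and
     then over \<open>?I\<close> compares the two integrals, up to the common factor \<open>?h\<close>.\<close>
  have "AE s\<in>?I in lebesgue. integral ?J V \<le> ?h * V s"
  proof (rule AE_completion, use profile_cone_AE_decreasing[OF L V] in eventually_elim, intro impI)
    fix s assume s: "s \<in> ?I" and *: "AE t in lborel. \<bar>s\<bar> \<le> t \<and> \<bar>s\<bar> \<le> 2 * L - t \<longrightarrow> V t \<le> V s"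
    have "(LINT t:?J|lebesgue. V t) \<le> (LINT t:?J|lebesgue. V s)"
    proof (rule set_integral_mono_AE[OF int])
      show "AE t\<in>?J in lebesgue. V t \<le> V s"
        by (rule AE_completion) (rule eventually_mono[OF *], use s assms in auto)
    qed auto
    then show "integral ?J V \<le> ?h * V s"
      using assms by (simp add: eq const)
  qed
  then have "(LINT s:?I|lebesgue. integral ?J V) \<le> (LINT s:?I|lebesgue. ?h * V s)"
    using int by (intro set_integral_mono_AE) auto
  then have "?h * integral ?J V \<le> ?h * integral ?I V"
    using assms by (simp add: const eq)
  then have "integral ?J V \<le> integral ?I V"
    using assms by (simp add: mult_le_cancel_left)
  then show ?thesis
    using avg_increment[OF PV, of x y] assms by simp
qed

text \<open>
  Averaging preserves the cone and regularizes its elements.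
\<close>

lemma continuous_profile_avg:
  assumes "1 \<le> L" and V: "V \<in> profile_cone L"
  shows "continuous_profile L (avg V)"
proof -
  have L: "L > 0" using assms by simp
  note PV = profile_cone_periodic_L2[OF L V]
  note Q = AE_completion[OF profile_cone_AE_even_nonneg[OF L V]]
  have "avg V (- x) = avg V x" for x
  proof -
    obtain N where N: "negligible N" "{x. \<not> (V (- x) = V x \<and> 0 \<le> V x)} \<subseteq> N"
      using Q unfolding eventually_ae_filter_negligible by auto
    have "avg V (- x) = integral {-(x + 1/2)..-(x - 1/2)} V"
      unfolding avg_eq_integral[OF PV] by (rule arg_cong2[where f = "\<lambda>a b. integral {a..b} V"]) simp_all
    also have "\<dots> = integral {x - 1/2..x + 1/2} (\<lambda>t. V (- t))"
      using Henstock_Kurzweil_Integration.integral_reflect_real[of "x + 1/2" "x - 1/2" "\<lambda>t. V (- t)"] by simp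
    also have "\<dots> = integral {x - 1/2..x + 1/2} V"
      using N(2) by (intro integral_spike[OF N(1)]) (metis (mono_tags, lifting) DiffD2 mem_Collect_eq subsetD)
    finally show ?thesis by (simp add: avg_eq_integral[OF PV])
  qed
  moreover have "0 \<le> avg V x" for x
    unfolding avg_def set_lebesgue_integral_def
    by (rule integral_nonneg_AE, use Q in eventually_elim) simp
  moreover have "avg V y \<le> avg V x" if "0 \<le> x" "x \<le> y" "y \<le> L" for x y
  proof -
    \<comment> \<open>Chain steps of length at most 1.\<close>
    have "x \<le> y \<and> y \<le> L \<and> y \<le> x + real n \<longrightarrow> avg V y \<le> avg V x" for n y
    proof (induction n arbitrary: y)
      case (Suc n)
      show ?case
      proof (intro impI)
        assume y: "x \<le> y \<and> y \<le> L \<and> y \<le> x + real (Suc n)"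
        show "avg V y \<le> avg V x"
        proof (cases "y \<le> x + real n")
          case False
          then have "avg V y \<le> avg V (x + real n)"
            using y \<open>0 \<le> x\<close> by (intro avg_decreasing_step[OF assms]) auto
          moreover have "avg V (x + real n) \<le> avg V x"
            using Suc[of "x + real n"] False y by auto
          ultimately show ?thesis by linarith
        qed (use Suc y in auto)
      qed
    qed auto
    moreover obtain n where "y - x \<le> real n"
      using real_arch_simple by blast
    ultimately show ?thesis
      using that by (smt (verit))
  qed
  ultimately show ?thesis
    unfolding continuous_profile_def using avg_continuous[OF PV] avg_periodic[OF PV] by blast
qed

text \<open>
  Arzela--Ascoli on one period; the limit extends to the line by periodicity, and every condition
  on a profile is closed under pointwise limits.
\<close>

lemma continuous_profile_limit_subsequence:
  fixes W :: "nat \<Rightarrow> real \<Rightarrow> real"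
  assumes "L > 0" and W: "\<And>n. continuous_profile L (W n)" and B: "\<And>n x. W n x \<le> B"
    and K: "\<And>n x y. \<bar>W n x - W n y\<bar> \<le> K * \<bar>x - y\<bar>"
  obtains k :: "nat \<Rightarrow> nat" and V where "strict_mono k" "continuous_profile L V" "\<And>x. (\<lambda>n. W (k n) x) \<longlonglongrightarrow> V x"
proof -
  note W' = continuous_profileD[OF W]
  have "0 \<le> K" using K[of 0 0 1] by simp
  obtain g and k :: "nat \<Rightarrow> nat" where "continuous_on {-L..L} g" and k: "strict_mono k"
    and g: "\<And>e. 0 < e \<Longrightarrow> \<exists>N. \<forall>n x. n \<ge> N \<and> x \<in> {-L..L} \<longrightarrow> norm (W (k n) x - g x) < e"
  proof (rule Arzela_Ascoli[of "{-L..L}" W B])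
    show "norm (W n x) \<le> B" for n x
      using B W'(5) by simp
    show "\<exists>d>0. \<forall>n y. y \<in> {-L..L} \<and> norm (x - y) < d \<longrightarrow> norm (W n x - W n y) < e" if "0 < e" for x e
    proof (intro exI conjI allI impI)
      show "0 < e / (K + 1)" using \<open>0 \<le> K\<close> that by simp
      fix n y assume "y \<in> {-L..L} \<and> norm (x - y) < e / (K + 1)"
      then have "(K + 1) * \<bar>x - y\<bar> < e"
        using \<open>0 \<le> K\<close> by (simp add: field_simps)
      moreover have "\<bar>W n x - W n y\<bar> \<le> (K + 1) * \<bar>x - y\<bar>"
        using K[of n x y] by (simp add: algebra_simps)
      ultimately show "norm (W n x - W n y) < e" by simp
    qed
  qed (simp, blast)
  have conv0: "(\<lambda>n. W (k n) x) \<longlonglongrightarrow> g x" if "x \<in> {-L..L}" for x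
    using g that unfolding LIMSEQ_def dist_norm by blast
  have "convergent (\<lambda>n. W (k n) x)" for x
  proof -
    obtain m :: int where x: "x - of_int m * (2 * L) \<in> {-L..L}"
      using shift_into_period[OF \<open>L > 0\<close>] by blast
    have "W n (x - of_int m * (2 * L)) = W n x" for n
    proof -
      interpret periodic_fun_simple "W n" "2 * L" by standard (rule W')
      show ?thesis by (rule minus_of_int)
    qed
    then show ?thesis
      using conv0[OF x] by (auto simp: convergent_def)
  qed
  then obtain V where V: "\<And>x. (\<lambda>n. W (k n) x) \<longlonglongrightarrow> V x"
    unfolding convergent_def by metis
  have Klim: "\<bar>V x - V y\<bar> \<le> K * \<bar>x - y\<bar>" for x y
    by (rule LIMSEQ_le_const2[of "\<lambda>n. \<bar>W (k n) x - W (k n) y\<bar>"]) (use K in \<open>auto intro!: tendsto_intros V\<close>)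
  have "continuous_profile L V"
    unfolding continuous_profile_def
  proof (intro conjI allI impI)
    have "K-lipschitz_on UNIV V"
      using Klim \<open>0 \<le> K\<close> by (auto simp: lipschitz_on_def dist_real_def)
    then show "continuous_on UNIV V"
      by (rule lipschitz_on_continuous_on)
    show "V (x + 2 * L) = V x" for x
      using LIMSEQ_unique[OF V[of "x + 2 * L"]] V[of x] by (simp add: W')
    show "V (- x) = V x" for x
      using LIMSEQ_unique[OF V[of "- x"]] V[of x] by (simp add: W')
    show "V y \<le> V x" if "0 \<le> x" "x \<le> y" "y \<le> L" for x y
      by (rule LIMSEQ_le[OF V V]) (use W'(4) that in auto)
    show "0 \<le> V x" for x
      by (rule LIMSEQ_le_const[OF V]) (use W'(5) in auto)
  qed
  with k V that show ?thesis by blast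
qed

lemma avg_tendsto:
  assumes "\<And>n. continuous_profile L (W n)" "\<And>n x. W n x \<le> B" "continuous_profile L V"
    and "\<And>x. (\<lambda>n. W n x) \<longlonglongrightarrow> V x"
  shows "(\<lambda>n. avg (W n) x) \<longlonglongrightarrow> avg V x"
  unfolding avg_eq_integral[OF continuous_profile_periodic_L2[OF assms(1)]]
    avg_eq_integral[OF continuous_profile_periodic_L2[OF assms(3)]]
proof (rule dominated_convergence(2)[where h = "\<lambda>_. B"])
  show "W n integrable_on {x - 1/2..x + 1/2}" for n
    by (rule periodic_L2_integrable[OF continuous_profile_periodic_L2[OF assms(1)]])
  show "norm (W n y) \<le> B" for n y
    using assms(2) continuous_profileD(5)[OF assms(1)] by simp
qed (use assms(4) in auto)

lemma integral_power2_tendsto: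
  assumes "\<And>n. continuous_profile L (W n)" "\<And>n x. W n x \<le> B" "continuous_profile L V"
    and "\<And>x. (\<lambda>n. W n x) \<longlonglongrightarrow> V x"
  shows "(\<lambda>n. integral {a..b} (\<lambda>x. (W n x)\<^sup>2)) \<longlonglongrightarrow> integral {a..b} (\<lambda>x. (V x)\<^sup>2)"
proof (rule dominated_convergence(2)[where h = "\<lambda>_. B\<^sup>2"])
  show "(\<lambda>x. (W n x)\<^sup>2) integrable_on {a..b}" for n
    using continuous_profile_periodic_L2[OF assms(1)] unfolding periodic_L2_def by blast
  show "norm ((W n y)\<^sup>2) \<le> B\<^sup>2" for n y
    using assms(2) continuous_profileD(5)[OF assms(1)] by (simp add: power_mono)
  show "(\<lambda>n. (W n x)\<^sup>2) \<longlonglongrightarrow> (V x)\<^sup>2" for x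
    by (intro tendsto_intros assms(4))
qed auto

section \<open>Convexity and gradient of the energy\<close>

text \<open>
  Here \<open>F\<close> is the derivative of \<open>\<Phi>\<close>; its monotonicity makes \<open>\<Phi>\<close> convex on \<open>{0..}\<close>, with minimum
  at 0.
\<close>

locale convex_potential =
  fixes F \<Phi> :: "real \<Rightarrow> real"
  assumes F_0: "F 0 = 0"
    and F_pos: "0 < r \<Longrightarrow> 0 < F r"
    and F_mono: "0 \<le> r \<Longrightarrow> r \<le> s \<Longrightarrow> F r \<le> F s"
    and F_cont: "continuous_on {0..} F"
    and \<Phi>_deriv: "0 \<le> r \<Longrightarrow> (\<Phi> has_real_derivative F r) (at r within {0..})"
begin

lemma F_nonneg: "0 \<le> r \<Longrightarrow> 0 \<le> F r"
  using F_0 F_pos[of r] by (cases "r = 0") auto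

lemma \<Phi>_cont: "continuous_on {0..} \<Phi>"
  unfolding continuous_on_eq_continuous_within using DERIV_continuous[OF \<Phi>_deriv] by simp

lemma \<Phi>_mean_value:
  assumes "0 \<le> a" "a \<le> b"
  obtains z where "a \<le> z" "z \<le> b" "\<Phi> b - \<Phi> a = F z * (b - a)"
proof -
  have "(\<Phi> has_derivative (*) (F x)) (at x within {a..b})" if "a \<le> x" "x \<le> b" for x
    using \<Phi>_deriv[of x] assms that
    by (auto simp: has_field_derivative_def intro: has_derivative_subset)
  from mvt_very_simple[OF assms(2) this] show ?thesis
    using that by auto
qed

lemma \<Phi>_above_tangent:
  assumes "0 \<le> a" "0 \<le> b"
  shows "F a * (b - a) \<le> \<Phi> b - \<Phi> a"
proof (cases "a \<le> b")
  case True
  then obtain z where z: "a \<le> z" "z \<le> b" "\<Phi> b - \<Phi> a = F z * (b - a)"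
    using \<Phi>_mean_value assms by blast
  then show ?thesis
    using F_mono[of a z] True assms by (simp add: mult_right_mono)
next
  case False
  then obtain z where z: "b \<le> z" "z \<le> a" "\<Phi> a - \<Phi> b = F z * (a - b)"
    using \<Phi>_mean_value[of b a] assms by auto
  then have "F z * (a - b) \<le> F a * (a - b)"
    using F_mono[of z a] False assms by (simp add: mult_right_mono)
  then show ?thesis
    using z by (simp add: algebra_simps)
qed

lemma \<Phi>_mono: "0 \<le> a \<Longrightarrow> a \<le> b \<Longrightarrow> \<Phi> a \<le> \<Phi> b"
  using \<Phi>_above_tangent[of a b] mult_nonneg_nonneg[OF F_nonneg[of a], of "b - a"] by linarith

lemma \<Phi>_pos:
  assumes "0 < r" shows "\<Phi> 0 < \<Phi> r"
proof -
  have "0 < F (r / 2) * (r - r / 2)"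
    using F_pos[of "r / 2"] assms by simp
  then show ?thesis
    using \<Phi>_above_tangent[of "r / 2" r] \<Phi>_mono[of 0 "r / 2"] assms by linarith
qed

lemma potential_energy_eq_integral:
  assumes "1 \<le> L" "0 < \<delta>" "V \<in> profile_cone L"
  shows "potential_energy L \<Phi> \<delta> V = integral {-L..L} (\<lambda>x. \<Phi> (avg V x / \<delta>))"
    and "continuous_on UNIV (\<lambda>x. \<Phi> (avg V x / \<delta>))"
proof -
  have R: "continuous_profile L (\<lambda>x. avg V x / \<delta>)"
    using continuous_profile_divide[OF continuous_profile_avg[OF assms(1,3)], of \<delta>] assms by simp
  show c: "continuous_on UNIV (\<lambda>x. \<Phi> (avg V x / \<delta>))"
    by (rule continuous_on_compose2[OF \<Phi>_cont continuous_profileD(1)[OF R]])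
      (use continuous_profileD(5)[OF R] in auto)
  have "(\<lambda>x. \<Phi> (avg V x / \<delta>)) absolutely_integrable_on {-L..L}"
    by (intro absolutely_integrable_continuous_real continuous_on_subset[OF c]) simp
  then show "potential_energy L \<Phi> \<delta> V = integral {-L..L} (\<lambda>x. \<Phi> (avg V x / \<delta>))"
    unfolding potential_energy_def by (rule set_lebesgue_integral_eq_integral(2))
qed

lemma potential_energy_const:
  assumes "0 < L"
  shows "potential_energy L \<Phi> \<delta> (\<lambda>_. c) = 2 * L * \<Phi> (c / \<delta>)"
  using assms unfolding potential_energy_def avg_const
  by (simp add: set_lebesgue_integral_eq_integral(2))

lemma potential_energy_le:
  assumes "1 \<le> L" "0 < \<delta>" "V \<in> profile_cone L"
  shows "potential_energy L \<Phi> \<delta> V \<le> 2 * L * \<Phi> (avg V 0 / \<delta>)"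
proof -
  have R: "continuous_profile L (avg V)"
    by (rule continuous_profile_avg[OF assms(1,3)])
  note avg = continuous_profileD[OF R]
  have "avg V x \<le> avg V 0" if "\<bar>x\<bar> \<le> L" for x
  proof -
    have "avg V x = avg V \<bar>x\<bar>"
      by (simp add: abs_if avg(3))
    also have "\<dots> \<le> avg V 0"
      using avg(4)[of 0 "\<bar>x\<bar>"] that by simp
    finally show ?thesis .
  qed
  then have "\<Phi> (avg V x / \<delta>) \<le> \<Phi> (avg V 0 / \<delta>)" if "x \<in> {-L..L}" for x
    using that assms avg(5) by (intro \<Phi>_mono divide_right_mono divide_nonneg_pos) auto
  moreover have "(\<lambda>x. \<Phi> (avg V x / \<delta>)) integrable_on {-L..L}"
    by (intro integrable_continuous_real continuous_on_subset[OF potential_energy_eq_integral(2)[OF assms]]) simp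
  ultimately have "potential_energy L \<Phi> \<delta> V \<le> integral {-L..L} (\<lambda>x. \<Phi> (avg V 0 / \<delta>))"
    unfolding potential_energy_eq_integral(1)[OF assms] by (intro integral_le) auto
  then show ?thesis using assms by simp
qed

lemma potential_energy_tendsto:
  assumes "1 \<le> L" "0 < \<delta>"
    and W: "\<And>n. continuous_profile L (W n)" "\<And>n x. W n x \<le> B" and V: "continuous_profile L V"
    and lim: "\<And>x. (\<lambda>n. W n x) \<longlonglongrightarrow> V x"
  shows "(\<lambda>n. potential_energy L \<Phi> \<delta> (W n)) \<longlonglongrightarrow> potential_energy L \<Phi> \<delta> V"
  unfolding potential_energy_eq_integral(1)[OF assms(1,2) continuous_profile_in_cone[OF W(1)]]
    potential_energy_eq_integral(1)[OF assms(1,2) continuous_profile_in_cone[OF V]]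
proof (rule dominated_convergence(2)[where h = "\<lambda>_. \<bar>\<Phi> 0\<bar> + \<bar>\<Phi> (B / \<delta>)\<bar>"])
  have R: "continuous_profile L (avg (W n))" for n
    by (rule continuous_profile_avg[OF assms(1) continuous_profile_in_cone[OF W(1)]])
  have RV: "continuous_profile L (avg V)"
    by (rule continuous_profile_avg[OF assms(1) continuous_profile_in_cone[OF V]])
  show "(\<lambda>x. \<Phi> (avg (W n) x / \<delta>)) integrable_on {-L..L}" for n
    by (intro integrable_continuous_real continuous_on_subset[OF
          potential_energy_eq_integral(2)[OF assms(1,2) continuous_profile_in_cone[OF W(1)]]]) simp
  show "norm (\<Phi> (avg (W n) x / \<delta>)) \<le> \<bar>\<Phi> 0\<bar> + \<bar>\<Phi> (B / \<delta>)\<bar>" for n x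
  proof -
    have "0 \<le> avg (W n) x / \<delta>" "avg (W n) x / \<delta> \<le> B / \<delta>"
      using continuous_profileD(5)[OF R] avg_le[OF continuous_profile_periodic_L2[OF W(1)] W(2)] assms(2)
      by (auto intro: divide_right_mono)
    then show ?thesis
      using \<Phi>_mono[of 0 "avg (W n) x / \<delta>"] \<Phi>_mono[of "avg (W n) x / \<delta>" "B / \<delta>"] by simp
  qed
  show "(\<lambda>n. \<Phi> (avg (W n) x / \<delta>)) \<longlonglongrightarrow> \<Phi> (avg V x / \<delta>)" for x
  proof (rule continuous_on_tendsto_compose[OF \<Phi>_cont])
    show "(\<lambda>n. avg (W n) x / \<delta>) \<longlonglongrightarrow> avg V x / \<delta>"
      using assms(2) by (intro tendsto_divide avg_tendsto[OF W V lim] tendsto_const) auto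
  qed (use continuous_profileD(5)[OF R] continuous_profileD(5)[OF RV] assms(2) in auto)
qed auto

text \<open>
  The \<open>L\<^sup>2\<close> gradient of the energy at \<open>V\<close>.
\<close>

definition gradient :: "real \<Rightarrow> (real \<Rightarrow> real) \<Rightarrow> real \<Rightarrow> real" where
  "gradient \<delta> V x = avg (\<lambda>y. F (avg V y / \<delta>)) x / \<delta>"

lemma continuous_profile_force:
  assumes "1 \<le> L" "0 < \<delta>" "V \<in> profile_cone L"
  shows "continuous_profile L (\<lambda>y. F (avg V y / \<delta>))"
proof (rule continuous_profile_compose[OF _ F_cont F_mono F_nonneg])
  show "continuous_profile L (\<lambda>y. avg V y / \<delta>)"
    using continuous_profile_divide[OF continuous_profile_avg[OF assms(1,3)], of \<delta>] assms by simp
qed auto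

lemma continuous_profile_gradient:
  assumes "1 \<le> L" "0 < \<delta>" "V \<in> profile_cone L"
  shows "continuous_profile L (gradient \<delta> V)"
  unfolding gradient_def[abs_def]
  using continuous_profile_avg[OF assms(1) continuous_profile_in_cone[OF continuous_profile_force[OF assms]]] assms(2)
  by (intro continuous_profile_divide) auto

lemma gradient_self_adjoint:
  assumes "1 \<le> L" "0 < \<delta>" "V \<in> profile_cone L" "W \<in> profile_cone L"
  shows "integral {-L..L} (\<lambda>x. gradient \<delta> V x * W x) = integral {-L..L} (\<lambda>x. F (avg V x / \<delta>) * avg W x) / \<delta>"
proof -
  have "integral {-L..L} (\<lambda>x. gradient \<delta> V x * W x) = integral {-L..L} (\<lambda>x. avg (\<lambda>y. F (avg V y / \<delta>)) x * W x) / \<delta>"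
    by (simp add: gradient_def)
  also have "integral {-L..L} (\<lambda>x. avg (\<lambda>y. F (avg V y / \<delta>)) x * W x) = integral {-L..L} (\<lambda>x. F (avg V x / \<delta>) * avg W x)"
    using assms continuous_profileD[OF continuous_profile_force[OF assms(1-3)]]
    by (intro avg_self_adjoint[symmetric] profile_cone_periodic_L2) auto
  finally show ?thesis .
qed

text \<open>
  Convexity of the energy: integrate the tangent inequality for \<open>\<Phi>\<close> at \<open>avg V x / \<delta>\<close> and move the
  averaging onto the force.
\<close>

lemma potential_energy_above_tangent:
  assumes "1 \<le> L" "0 < \<delta>" "V \<in> profile_cone L" "W \<in> profile_cone L"
  shows "integral {-L..L} (\<lambda>x. gradient \<delta> V x * W x) - integral {-L..L} (\<lambda>x. gradient \<delta> V x * V x)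
    \<le> potential_energy L \<Phi> \<delta> W - potential_energy L \<Phi> \<delta> V"
proof -
  have RV: "continuous_profile L (avg V)" and RW: "continuous_profile L (avg W)"
    and F: "continuous_profile L (\<lambda>y. F (avg V y / \<delta>))"
    by (rule continuous_profile_avg continuous_profile_force assms)+
  note cont = continuous_profileD(1)[OF RV] continuous_profileD(1)[OF RW] continuous_profileD(1)[OF F]
  note nonneg = continuous_profileD(5)[OF RV] continuous_profileD(5)[OF RW]
  have int: "f integrable_on {-L..L}" if "continuous_on UNIV f" for f :: "real \<Rightarrow> real"
    by (intro integrable_continuous_real continuous_on_subset[OF that]) simp
  let ?V = "\<lambda>x. F (avg V x / \<delta>) * avg V x / \<delta>" and ?W = "\<lambda>x. F (avg V x / \<delta>) * avg W x / \<delta>"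
  have i: "?V integrable_on {-L..L}" "?W integrable_on {-L..L}"
    "(\<lambda>x. \<Phi> (avg V x / \<delta>)) integrable_on {-L..L}" "(\<lambda>x. \<Phi> (avg W x / \<delta>)) integrable_on {-L..L}"
    by (rule int, use assms in \<open>intro continuous_on_divide continuous_on_mult cont continuous_on_const
          potential_energy_eq_integral(2), simp_all\<close>)+
  have "integral {-L..L} (\<lambda>x. gradient \<delta> V x * W x) - integral {-L..L} (\<lambda>x. gradient \<delta> V x * V x)
      = integral {-L..L} (\<lambda>x. F (avg V x / \<delta>) * avg W x) / \<delta> - integral {-L..L} (\<lambda>x. F (avg V x / \<delta>) * avg V x) / \<delta>"
    using assms by (simp add: gradient_self_adjoint)
  also have "\<dots> = integral {-L..L} (\<lambda>x. ?W x - ?V x)"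
    unfolding integral_diff[OF i(2,1)] by simp
  also have "\<dots> \<le> integral {-L..L} (\<lambda>x. \<Phi> (avg W x / \<delta>) - \<Phi> (avg V x / \<delta>))"
  proof (rule integral_le)
    show "?W x - ?V x \<le> \<Phi> (avg W x / \<delta>) - \<Phi> (avg V x / \<delta>)" for x
      using \<Phi>_above_tangent[of "avg V x / \<delta>" "avg W x / \<delta>"] nonneg assms
      by (simp add: right_diff_distrib)
  qed (intro integrable_diff i)+
  also have "\<dots> = potential_energy L \<Phi> \<delta> W - potential_energy L \<Phi> \<delta> V"
    unfolding integral_diff[OF i(4,3)] using assms by (simp add: potential_energy_eq_integral(1))
  finally show ?thesis .
qed

text \<open>
  Compare the tangent at \<open>V\<close> with the energy of the zero profile: a profile whose energy exceeds
  that of rest has a gradient of a definite size.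
\<close>

lemma gradient_norm_ge:
  assumes "1 \<le> L" "0 < \<delta>" "V \<in> profile_cone L" "L2_norm_on L V = 1"
  shows "potential_energy L \<Phi> \<delta> V - 2 * L * \<Phi> 0 \<le> L2_norm_on L (gradient \<delta> V)"
proof -
  have PV: "periodic_L2 L V"
    using assms profile_cone_periodic_L2 by simp
  have "integral {-L..L} (\<lambda>x. gradient \<delta> V x * 0) - integral {-L..L} (\<lambda>x. gradient \<delta> V x * V x)
      \<le> potential_energy L \<Phi> \<delta> (\<lambda>_. 0) - potential_energy L \<Phi> \<delta> V"
    by (rule potential_energy_above_tangent[OF assms(1-3) continuous_profile_in_cone[OF continuous_profile_const]]) simp
  moreover have "potential_energy L \<Phi> \<delta> (\<lambda>_. 0) = 2 * L * \<Phi> 0"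
    using potential_energy_const[of L \<delta> 0] assms(1) by simp
  moreover have "integral {-L..L} (\<lambda>x. gradient \<delta> V x * V x) \<le> L2_norm_on L (gradient \<delta> V)"
    by (rule integral_Cauchy_Schwarz[OF PV continuous_profile_periodic_L2[OF continuous_profile_gradient[OF assms(1-3)]] assms(4)])
  ultimately show ?thesis by simp
qed

text \<open>
  The engine of the existence proof. The left-hand side is nonnegative by Cauchy--Schwarz when \<open>V\<close>
  is a unit vector, so replacing \<open>V\<close> by its normalized gradient never decreases the energy; and if
  nothing is gained, Cauchy--Schwarz is an equality and \<open>V\<close> is parallel to its gradient.
\<close>

lemma potential_energy_normalized_gradient:
  fixes \<delta> L :: real and V :: "real \<Rightarrow> real"
  defines "n \<equiv> L2_norm_on L (gradient \<delta> V)"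
  assumes "1 \<le> L" "0 < \<delta>" "V \<in> profile_cone L" "0 < n"
  shows "n - integral {-L..L} (\<lambda>x. gradient \<delta> V x * V x)
    \<le> potential_energy L \<Phi> \<delta> (\<lambda>x. gradient \<delta> V x / n) - potential_energy L \<Phi> \<delta> V"
proof -
  have G: "continuous_profile L (gradient \<delta> V)"
    by (rule continuous_profile_gradient[OF assms(2-4)])
  have "integral {-L..L} (\<lambda>x. gradient \<delta> V x * (gradient \<delta> V x / n)) = integral {-L..L} (\<lambda>x. (gradient \<delta> V x)\<^sup>2) / n"
    by (simp add: power2_eq_square)
  also have "\<dots> = n"
    using \<open>0 < n\<close> unfolding integral_power2_eq[OF continuous_profile_periodic_L2[OF G]] n_def[symmetric]
    by (simp add: power2_eq_square)
  finally have "integral {-L..L} (\<lambda>x. gradient \<delta> V x * (gradient \<delta> V x / n)) = n" .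
  moreover have "(\<lambda>x. gradient \<delta> V x / n) \<in> profile_cone L"
    using \<open>0 < n\<close> by (intro continuous_profile_in_cone continuous_profile_divide[OF G]) simp
  ultimately show ?thesis
    using potential_energy_above_tangent[OF assms(2-4), of "\<lambda>x. gradient \<delta> V x / n"] by metis
qed

section \<open>Existence of continuous maximizers\<close>

text \<open>
  Provides a competitor whose energy is strictly above that of the zero profile, so that the
  supremum is too.
\<close>

lemma constant_profile_energy:
  assumes "1 \<le> L" "0 < \<delta>"
  obtains V where "continuous_profile L V" "L2_norm_on L V = 1" "2 * L * \<Phi> 0 < potential_energy L \<Phi> \<delta> V"
proof
  let ?c = "1 / sqrt (2 * L)"
  show c: "continuous_profile L (\<lambda>_. ?c)"
    using assms by (intro continuous_profile_const) simp
  have "(LINT x:{-L..L}|lebesgue. ?c\<^sup>2) = 1"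
    using assms by (simp add: set_lebesgue_integral_eq_integral(2) power_divide)
  then show "L2_norm_on L (\<lambda>_. ?c) = 1"
    unfolding L2_norm_on_def by simp
  show "2 * L * \<Phi> 0 < potential_energy L \<Phi> \<delta> (\<lambda>_. ?c)"
    using assms \<Phi>_pos[of "?c / \<delta>"] by (simp add: potential_energy_const)
qed

text \<open>
  Since \<open>avg V \<le> 1\<close> for every unit vector, these bounds are uniform over all profiles whose gradient
  has norm at least \<open>\<kappa>\<close>; this is the equicontinuity that Arzela--Ascoli needs.
\<close>

lemma normalized_gradient_bounds:
  assumes "1 \<le> L" "0 < \<delta>" "V \<in> profile_cone L" "L2_norm_on L V = 1" "0 < \<kappa>" "\<kappa> \<le> n"
  shows "gradient \<delta> V x / n \<le> F (1 / \<delta>) / \<delta> / \<kappa>"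
    and "\<bar>gradient \<delta> V x / n - gradient \<delta> V y / n\<bar> \<le> F (1 / \<delta>) / \<delta> / \<kappa> * \<bar>x - y\<bar>"
proof -
  let ?f = "\<lambda>y. F (avg V y / \<delta>)"
  have R: "continuous_profile L (avg V)"
    by (rule continuous_profile_avg[OF assms(1,3)])
  have f: "continuous_profile L ?f"
    by (rule continuous_profile_force[OF assms(1-3)])
  have "avg V y \<le> 1" for y
    using avg_le_L2_norm[of L V y] assms profile_cone_periodic_L2[of L V] by simp
  then have fM: "?f y \<le> F (1 / \<delta>)" for y
    using continuous_profileD(5)[OF R] assms(2) by (intro F_mono) (auto intro: divide_right_mono)
  have M: "0 \<le> F (1 / \<delta>)" using assms(2) by (intro F_nonneg) simp
  have div: "a / \<delta> / n \<le> b / \<delta> / \<kappa>" if "a \<le> b" "0 \<le> b" for a b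
  proof -
    have "a / \<delta> / n \<le> b / \<delta> / n"
      using that assms by (intro divide_right_mono) auto
    also have "\<dots> \<le> b / \<delta> / \<kappa>"
      using that assms by (intro divide_left_mono) auto
    finally show ?thesis .
  qed
  show "gradient \<delta> V x / n \<le> F (1 / \<delta>) / \<delta> / \<kappa>"
    unfolding gradient_def by (intro div avg_le[OF continuous_profile_periodic_L2[OF f]] fM M)
  have "\<bar>gradient \<delta> V x / n - gradient \<delta> V y / n\<bar> = \<bar>avg ?f x - avg ?f y\<bar> / \<delta> / n"
    unfolding gradient_def diff_divide_distrib[symmetric] using assms by (simp add: abs_divide)
  also have "\<dots> \<le> F (1 / \<delta>) * \<bar>x - y\<bar> / \<delta> / \<kappa>"
    using M by (intro div avg_Lipschitz[OF continuous_profile_periodic_L2[OF f] continuous_profileD(5)[OF f] fM]) simp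
  finally show "\<bar>gradient \<delta> V x / n - gradient \<delta> V y / n\<bar> \<le> F (1 / \<delta>) / \<delta> / \<kappa> * \<bar>x - y\<bar>"
    by simp
qed

text \<open>
  A maximizing sequence of rough profiles is first replaced by its normalized gradients, which are
  still maximizing and uniformly Lipschitz. A limit of these is a maximizer that is continuous.
\<close>

lemma continuous_maximizer_exists:
  assumes "1 \<le> L" "0 < \<delta>"
  obtains V where "continuous_profile L V" "maximizer L \<Phi> \<delta> V"
proof -
  define A where "A = {V. L2_norm_on L V = 1 \<and> V \<in> profile_cone L}"
  let ?E = "potential_energy L \<Phi> \<delta>"
  obtain V1 where V1: "continuous_profile L V1" "L2_norm_on L V1 = 1" "2 * L * \<Phi> 0 < ?E V1"
    using constant_profile_energy[OF assms] by blast
  then have V1A: "V1 \<in> A"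
    unfolding A_def using continuous_profile_in_cone by simp
  have bound: "?E V \<le> 2 * L * \<Phi> (1 / \<delta>)" if "V \<in> A" for V
  proof -
    have "continuous_profile L (avg V)"
      using that assms unfolding A_def by (intro continuous_profile_avg) auto
    then have "0 \<le> avg V 0"
      by (rule continuous_profileD(5))
    moreover have "avg V 0 \<le> 1"
      using that assms avg_le_L2_norm[of L V 0] profile_cone_periodic_L2[of L V] unfolding A_def by simp
    ultimately have "\<Phi> (avg V 0 / \<delta>) \<le> \<Phi> (1 / \<delta>)"
      using assms by (intro \<Phi>_mono divide_right_mono) auto
    then show ?thesis
      using potential_energy_le[of L \<delta> V] that assms unfolding A_def
      by (smt (verit) mem_Collect_eq mult_left_mono)
  qed
  define S where "S = Sup (?E ` A)"
  have bdd: "bdd_above (?E ` A)"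
    using bound by (intro bdd_aboveI2)
  have le_S: "?E V \<le> S" if "V \<in> A" for V
    unfolding S_def using bdd that by (intro cSup_upper) auto
  \<comment> \<open>Staying above the energy of \<open>V1\<close> keeps the norms of the gradients away from 0.\<close>
  have "\<exists>V. V \<in> A \<and> ?E V1 \<le> ?E V \<and> S - inverse (real (Suc n)) < ?E V" for n
  proof -
    have "\<exists>e\<in>?E ` A. S - inverse (real (Suc n)) < e"
      unfolding S_def using V1A bdd by (subst less_cSup_iff[symmetric]) auto
    then obtain V where "V \<in> A" "S - inverse (real (Suc n)) < ?E V" by blast
    then show ?thesis
      using V1A by (meson less_le_trans linear order_refl)
  qed
  then obtain V where V: "\<And>n. V n \<in> A" "\<And>n. ?E V1 \<le> ?E (V n)" "\<And>n. S - inverse (real (Suc n)) < ?E (V n)"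
    by metis
  have VA: "V n \<in> profile_cone L" "L2_norm_on L (V n) = 1" for n
    using V(1)[of n] unfolding A_def by auto
  \<comment> \<open>The improved sequence \<open>W\<close> is still maximizing, and in addition precompact.\<close>
  define N where "N = (\<lambda>n. L2_norm_on L (gradient \<delta> (V n)))"
  define W where "W = (\<lambda>n x. gradient \<delta> (V n) x / N n)"
  define \<kappa> where "\<kappa> = ?E V1 - 2 * L * \<Phi> 0"
  have \<kappa>: "0 < \<kappa>" "\<kappa> \<le> N n" for n
    using V1(3) V(2)[of n] gradient_norm_ge[OF assms VA[of n]] unfolding \<kappa>_def N_def by linarith+
  have N: "0 < N n" for n
    using \<kappa>(1) \<kappa>(2)[of n] by linarith
  have G: "continuous_profile L (gradient \<delta> (V n))" for n
    by (rule continuous_profile_gradient[OF assms VA(1)])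
  have W: "continuous_profile L (W n)" for n
    unfolding W_def using N[of n] by (intro continuous_profile_divide[OF G]) simp
  have W1: "L2_norm_on L (W n) = 1" for n
    unfolding W_def N_def
    by (rule L2_norm_on_divide[OF continuous_profile_periodic_L2[OF G]]) (use N[of n] in \<open>simp add: N_def\<close>)
  have EW: "?E (V n) \<le> ?E (W n)" for n
    using potential_energy_normalized_gradient[OF assms VA(1)[of n]] N[of n]
      integral_Cauchy_Schwarz[OF profile_cone_periodic_L2 continuous_profile_periodic_L2[OF G[of n]] VA(2)[of n]] VA(1)[of n] assms
    unfolding W_def N_def by fastforce
  define B where "B = F (1 / \<delta>) / \<delta> / \<kappa>"
  have WB: "W n x \<le> B" and WL: "\<bar>W n x - W n y\<bar> \<le> B * \<bar>x - y\<bar>" for n x y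
    unfolding W_def B_def using normalized_gradient_bounds[OF assms VA[of n] \<kappa>] by blast+
  obtain k U where k: "strict_mono k" and U: "continuous_profile L U" "\<And>x. (\<lambda>n. W (k n) x) \<longlonglongrightarrow> U x"
    by (rule continuous_profile_limit_subsequence[of L W B B, OF _ W WB WL]) (use assms in auto)
  have "(\<lambda>n. integral {-L..L} (\<lambda>x. (W (k n) x)\<^sup>2)) \<longlonglongrightarrow> integral {-L..L} (\<lambda>x. (U x)\<^sup>2)"
    by (rule integral_power2_tendsto[OF W WB U])
  then have "integral {-L..L} (\<lambda>x. (U x)\<^sup>2) = 1"
    by (simp add: integral_power2_eq[OF continuous_profile_periodic_L2[OF W]] W1 LIMSEQ_const_iff)
  then have U1: "L2_norm_on L U = 1"
    by (simp add: L2_norm_on_eq[OF continuous_profile_periodic_L2[OF U(1)]])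
  have "S \<le> ?E U"
  proof (rule LIMSEQ_le)
    show "(\<lambda>n. ?E (W (k n))) \<longlonglongrightarrow> ?E U"
      by (rule potential_energy_tendsto[OF assms W WB U])
    have "(\<lambda>n. S - inverse (real (Suc n))) \<longlonglongrightarrow> S - 0"
      by (intro tendsto_diff tendsto_const LIMSEQ_inverse_real_of_nat)
    then show "(\<lambda>n. S - inverse (real (Suc (k n)))) \<longlonglongrightarrow> S"
      using LIMSEQ_subseq_LIMSEQ[OF _ k] by (fastforce simp: o_def)
    show "\<exists>N. \<forall>n\<ge>N. S - inverse (real (Suc (k n))) \<le> ?E (W (k n))"
      using V(3) EW by (meson less_imp_le order_trans)
  qed
  then have "maximizer L \<Phi> \<delta> U"
    unfolding maximizer_def is_arg_max_def
    using U1 continuous_profile_in_cone[OF U(1)] le_S unfolding A_def by fastforce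
  with U(1) that show ?thesis by blast
qed

end

section \<open>Maximizers are traveling waves\<close>

lemma zero_of_neighbours_zero:
  fixes V :: "real \<Rightarrow> real"
  assumes step: "\<And>x z. V x = 0 \<Longrightarrow> \<bar>z - x\<bar> \<le> 1 \<Longrightarrow> V z = 0" and "V x = 0"
  shows "V z = 0"
proof -
  have "\<bar>z - x\<bar> \<le> real n \<longrightarrow> V z = 0" for n z
  proof (induction n arbitrary: z)
    case 0
    then show ?case using \<open>V x = 0\<close> by auto
  next
    case (Suc n)
    show ?case
    proof
      assume z: "\<bar>z - x\<bar> \<le> real (Suc n)"
      \<comment> \<open>At most one unit step from \<open>z\<close> towards \<open>x\<close>.\<close>
      define y where "y = (if z - x > 1 then z - 1 else if z - x < -1 then z + 1 else x)"
      have "\<bar>y - x\<bar> \<le> real n" "\<bar>z - y\<bar> \<le> 1"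
        using z by (auto simp: y_def abs_le_iff)
      then show "V z = 0" using Suc[of y] step[of y z] by blast
    qed
  qed
  then show ?thesis using real_arch_simple by blast
qed

context convex_potential
begin

text \<open>
  The traveling wave equation in the form of an Euler--Lagrange equation, with the norm of the
  gradient as multiplier. It comes from the equality case of Cauchy--Schwarz rather than from a
  variation, which would have to respect the constraint of the cone.
\<close>

lemma maximizer_gradient:
  assumes "1 \<le> L" "0 < \<delta>" and V: "continuous_profile L V" and max: "maximizer L \<Phi> \<delta> V"
  shows "0 < L2_norm_on L (gradient \<delta> V)" "gradient \<delta> V x = L2_norm_on L (gradient \<delta> V) * V x"
proof -
  let ?E = "potential_energy L \<Phi> \<delta>"
  define G where "G = gradient \<delta> V"
  define n where "n = L2_norm_on L G"
  have VC: "V \<in> profile_cone L" by (rule continuous_profile_in_cone[OF V])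
  have G: "continuous_profile L G"
    unfolding G_def by (rule continuous_profile_gradient[OF assms(1,2) VC])
  note PV = continuous_profile_periodic_L2[OF V] and PG = continuous_profile_periodic_L2[OF G]
  have V1: "L2_norm_on L V = 1" and best: "\<And>W. L2_norm_on L W = 1 \<Longrightarrow> W \<in> profile_cone L \<Longrightarrow> ?E W \<le> ?E V"
    using max unfolding maximizer_def is_arg_max_def by (auto simp: not_less)
  obtain U where "continuous_profile L U" "L2_norm_on L U = 1" "2 * L * \<Phi> 0 < ?E U"
    using constant_profile_energy[OF assms(1,2)] by blast
  then have "2 * L * \<Phi> 0 < ?E V"
    using best[OF _ continuous_profile_in_cone, of U] by fastforce
  then have n: "0 < n"
    using gradient_norm_ge[OF assms(1,2) VC V1] unfolding n_def G_def by linarith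
  \<comment> \<open>The normalized gradient cannot beat the maximizer.\<close>
  have "?E (\<lambda>x. G x / n) \<le> ?E V"
    using n unfolding n_def
    by (intro best L2_norm_on_divide[OF PG] continuous_profile_in_cone continuous_profile_divide[OF G]) auto
  then have "n \<le> integral {-L..L} (\<lambda>x. G x * V x)"
    using potential_energy_normalized_gradient[OF assms(1,2) VC] n unfolding n_def G_def by fastforce
  then have "n * n \<le> n * integral {-L..L} (\<lambda>x. G x * V x)"
    using n by simp
  moreover have "integral {-L..L} (\<lambda>x. (G x - n * V x)\<^sup>2)
      = n * n - 2 * (n * integral {-L..L} (\<lambda>x. G x * V x)) + n * n"
    unfolding integral_power2_diff[OF PG PV] integral_power2_eq[OF PG] integral_power2_eq[OF PV] V1 n_def[symmetric]
    by (simp add: power2_eq_square)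
  moreover have "0 \<le> integral {-L..L} (\<lambda>x. (G x - n * V x)\<^sup>2)"
    by (rule integral_nonneg) (use periodic_L2_diff[OF PG PV, of n] in \<open>auto simp: periodic_L2_def\<close>)
  ultimately have zero: "integral {-L..L} (\<lambda>x. (G x - n * V x)\<^sup>2) = 0"
    by linarith
  have "continuous_on {-L..L} (\<lambda>x. (G x - n * V x)\<^sup>2)"
    by (intro continuous_intros continuous_on_subset[OF continuous_profileD(1)[OF G]]
        continuous_on_subset[OF continuous_profileD(1)[OF V]]) auto
  then have "\<forall>x\<in>{-L..L}. (G x - n * V x)\<^sup>2 = 0"
    using zero assms(1) by (subst (asm) integral_eq_0_iff) auto
  then have eq: "G x = n * V x" if "x \<in> {-L..L}" for x
    using that by simp
  have "G x = n * V x" for x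
  proof -
    interpret G: periodic_fun_simple G "2 * L" by standard (rule continuous_profileD(2)[OF G])
    interpret V: periodic_fun_simple V "2 * L" by standard (rule continuous_profileD(2)[OF V])
    obtain m :: int where "x - of_int m * (2 * L) \<in> {-L..L}"
      using shift_into_period[of L x] assms(1) by auto
    from eq[OF this] show ?thesis
      by (simp add: G.minus_of_int V.minus_of_int)
  qed
  then show "0 < L2_norm_on L (gradient \<delta> V)" "gradient \<delta> V x = L2_norm_on L (gradient \<delta> V) * V x"
    using n unfolding n_def G_def by blast+
qed

text \<open>
  A zero of \<open>V\<close> spreads: the wave equation forces \<open>avg V\<close> to vanish within distance 1/2 of it, and
  hence \<open>V\<close> within distance 1. So \<open>V\<close> would vanish identically.
\<close>

lemma maximizer_positive:
  assumes "1 \<le> L" "0 < \<delta>" and V: "continuous_profile L V" and max: "maximizer L \<Phi> \<delta> V"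
  shows "0 < V x" "0 < avg V x"
proof -
  have R: "continuous_profile L (avg V)"
    by (rule continuous_profile_avg[OF assms(1) continuous_profile_in_cone[OF V]])
  have f: "continuous_profile L (\<lambda>y. F (avg V y / \<delta>))"
    by (rule continuous_profile_force[OF assms(1,2) continuous_profile_in_cone[OF V]])
  have step: "V z = 0" if "V x = 0" "\<bar>z - x\<bar> \<le> 1" for x z
  proof -
    \<comment> \<open>The averages over half-neighbourhoods of \<open>x\<close> and of the midpoint \<open>y\<close> link \<open>x\<close> to \<open>z\<close>.\<close>
    define y where "y = (x + z) / 2"
    have y: "\<bar>y - x\<bar> \<le> 1/2" "\<bar>z - y\<bar> \<le> 1/2"
      using that(2) unfolding y_def by (auto simp: abs_le_iff field_simps)
    have "avg (\<lambda>y. F (avg V y / \<delta>)) x = 0"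
      using maximizer_gradient(2)[OF assms, of x] \<open>V x = 0\<close> assms(2) by (simp add: gradient_def)
    then have "F (avg V y / \<delta>) = 0"
      by (rule avg_eq_0_imp[OF continuous_profileD(1)[OF f] continuous_profile_periodic_L2[OF f]
            continuous_profileD(5)[OF f] _ y(1)])
    then have "\<not> 0 < avg V y / \<delta>"
      using F_pos[of "avg V y / \<delta>"] by auto
    then have "avg V y = 0"
      using continuous_profileD(5)[OF R, of y] assms(2) by (simp add: zero_less_divide_iff)
    then show "V z = 0"
      by (rule avg_eq_0_imp[OF continuous_profileD(1)[OF V] continuous_profile_periodic_L2[OF V]
            continuous_profileD(5)[OF V] _ y(2)])
  qed
  have "V x \<noteq> 0" for x
  proof
    assume "V x = 0"
    then have "V z = 0" for z
      using zero_of_neighbours_zero[of V x z] step by blast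
    then have "V = (\<lambda>_. 0)" by blast
    then show False
      using max unfolding maximizer_def is_arg_max_def L2_norm_on_def by auto
  qed
  then show pos: "0 < V x" for x
    using continuous_profileD(5)[OF V, of x] by (simp add: less_le)
  have "avg V x \<noteq> 0"
    using avg_eq_0_imp[OF continuous_profileD(1)[OF V] continuous_profile_periodic_L2[OF V]
        continuous_profileD(5)[OF V], of x x] pos[of x] by auto
  then show "0 < avg V x"
    using continuous_profileD(5)[OF R, of x] by (simp add: less_le)
qed

text \<open>
  The multiplier \<open>lam\<close> is the square root of the norm of the gradient. Both \<open>avg V\<close> and, by the
  wave equation, \<open>V\<close> are averages of continuous functions, which gives their derivatives.
\<close>

lemma traveling_wave:
  assumes "1 \<le> L" "0 < \<delta>"
  shows "\<exists>V lam. maximizer L \<Phi> \<delta> V \<and> lam\<^sup>2 > 0 \<and> (let R = avg V in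
        (\<forall>x. lam\<^sup>2 * V x = 1 / \<delta> * avg (\<lambda>y. F (avg V y / \<delta>)) x)
      \<and> (\<forall>x. (R has_real_derivative V (x + 1/2) - V (x - 1/2)) (at x))
      \<and> (\<forall>x. (V has_real_derivative
               1 / (\<delta> * lam\<^sup>2) * (F (R (x + 1/2) / \<delta>) - F (R (x - 1/2) / \<delta>))) (at x))
      \<and> L2_norm_on L V = 1
      \<and> periodic_fun_simple V (2 * L) \<and> periodic_fun_simple R (2 * L)
      \<and> V \<in> profile_cone L \<and> R \<in> profile_cone L
      \<and> (\<forall>x. V x > 0) \<and> (\<forall>x. R x > 0))"
proof -
  obtain V where V: "continuous_profile L V" and max: "maximizer L \<Phi> \<delta> V"
    using continuous_maximizer_exists[OF assms] by blast
  define n where "n = L2_norm_on L (gradient \<delta> V)"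
  note n = maximizer_gradient(1)[OF assms V max, folded n_def]
  note grad = maximizer_gradient(2)[OF assms V max, folded n_def]
  have R: "continuous_profile L (avg V)"
    by (rule continuous_profile_avg[OF assms(1) continuous_profile_in_cone[OF V]])
  have f: "continuous_profile L (\<lambda>y. F (avg V y / \<delta>))"
    by (rule continuous_profile_force[OF assms continuous_profile_in_cone[OF V]])
  have "V = (\<lambda>x. 1 / (\<delta> * n) * avg (\<lambda>y. F (avg V y / \<delta>)) x)"
    using n grad assms(2) by (auto simp: gradient_def fun_eq_iff field_simps)
  moreover have "((\<lambda>x. 1 / (\<delta> * n) * avg (\<lambda>y. F (avg V y / \<delta>)) x) has_real_derivative
      1 / (\<delta> * n) * (F (avg V (x + 1/2) / \<delta>) - F (avg V (x - 1/2) / \<delta>))) (at x)" for x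
    by (rule DERIV_cmult[OF avg_has_derivative[OF continuous_profileD(1)[OF f] continuous_profile_periodic_L2[OF f]]])
  ultimately have "(V has_real_derivative
      1 / (\<delta> * n) * (F (avg V (x + 1/2) / \<delta>) - F (avg V (x - 1/2) / \<delta>))) (at x)" for x
    by metis
  moreover have "n * V x = 1 / \<delta> * avg (\<lambda>y. F (avg V y / \<delta>)) x" for x
    using grad[of x] by (simp add: gradient_def)
  moreover have "periodic_fun_simple V (2 * L)" "periodic_fun_simple (avg V) (2 * L)"
    using continuous_profileD(2)[OF V] continuous_profileD(2)[OF R] by (simp_all add: periodic_fun_simple_def)
  moreover have "L2_norm_on L V = 1"
    using max unfolding maximizer_def is_arg_max_def by blast
  moreover have "(sqrt n)\<^sup>2 = n" using n by simp
  moreover note n max continuous_profile_in_cone[OF V] continuous_profile_in_cone[OF R]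
    avg_has_derivative[OF continuous_profileD(1)[OF V] continuous_profile_periodic_L2[OF V]]
    maximizer_positive[OF assms V max]
  ultimately show ?thesis
    unfolding Let_def by (intro exI[of _ V] exI[of _ "sqrt n"]) simp
qed

end

section \<open>The high-energy limit\<close>

text \<open>
  Windows centred in the period reach at most to \<open>L + 1/2\<close>, where the neighbouring copies of the
  interval have not begun yet.
\<close>

lemma limit_velocity_eq_indicator:
  assumes "1 < L" "\<bar>x\<bar> \<le> L + 1/2"
  shows "limit_velocity L x = indicator {-1/2..1/2} x"
proof -
  have other: "x \<notin> {2 * L * k - 1/2..2 * L * k + 1/2}" if "k \<noteq> 0" for k :: int
  proof -
    have "\<bar>real_of_int k\<bar> \<ge> 1" using that by linarith
    then have "2 * L * 1 \<le> 2 * L * \<bar>real_of_int k\<bar>"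
      using assms(1) by (intro mult_left_mono) auto
    moreover have "2 * L * \<bar>real_of_int k\<bar> = \<bar>2 * L * real_of_int k\<bar>"
      using assms(1) by (simp add: abs_mult)
    ultimately show ?thesis
      using assms unfolding atLeastAtMost_iff by linarith
  qed
  have "x \<in> (\<Union>k::int. {2 * L * k - 1/2..2 * L * k + 1/2}) \<longleftrightarrow> x \<in> {-1/2..1/2}"
  proof
    assume "x \<in> (\<Union>k::int. {2 * L * k - 1/2..2 * L * k + 1/2})"
    then obtain k :: int where k: "x \<in> {2 * L * k - 1/2..2 * L * k + 1/2}" by blast
    then have "k = 0" using other by blast
    with k show "x \<in> {-1/2..1/2}" by simp
  next
    assume "x \<in> {-1/2..1/2}"
    then have "x \<in> {2 * L * of_int (0::int) - 1/2..2 * L * of_int (0::int) + 1/2}" by simp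
    then show "x \<in> (\<Union>k::int. {2 * L * k - 1/2..2 * L * k + 1/2})" by blast
  qed
  then show ?thesis
    unfolding limit_velocity_def indicator_def by simp
qed

lemma limit_velocity_in_cone:
  assumes "1 < L"
  shows "limit_velocity L \<in> profile_cone L"
proof -
  have "limit_velocity L (x + 2 * L) = limit_velocity L x" for x
  proof -
    have "(\<exists>k::int. x + 2 * L \<in> {2 * L * k - 1/2..2 * L * k + 1/2}) \<longleftrightarrow> (\<exists>k::int. x \<in> {2 * L * k - 1/2..2 * L * k + 1/2})"
    proof (intro iffI; elim exE)
      show "\<exists>k::int. x \<in> {2 * L * k - 1/2..2 * L * k + 1/2}" if "x + 2 * L \<in> {2 * L * k - 1/2..2 * L * k + 1/2}" for k :: int
        using that by (intro exI[of _ "k - 1"]) (simp add: algebra_simps)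
      show "\<exists>k::int. x + 2 * L \<in> {2 * L * k - 1/2..2 * L * k + 1/2}" if "x \<in> {2 * L * k - 1/2..2 * L * k + 1/2}" for k :: int
        using that by (intro exI[of _ "k + 1"]) (simp add: algebra_simps)
    qed
    then show ?thesis unfolding limit_velocity_def indicator_def by simp
  qed
  then have per: "periodic_fun_simple (limit_velocity L) (2 * L)"
    unfolding periodic_fun_simple_def by blast
  have eq: "limit_velocity L x = indicator {-1/2..1/2} x" if "\<bar>x\<bar> \<le> L" for x
    using limit_velocity_eq_indicator[of L x] that assms by simp
  have "indicat_real {-L..L} x *\<^sub>R limit_velocity L x = indicat_real {-1/2..1/2} x" for x
    using eq[of x] assms by (cases "\<bar>x\<bar> \<le> L") (auto simp: indicator_def abs_le_iff)
  then have "set_borel_measurable lebesgue {-L..L} (limit_velocity L)"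
    unfolding set_borel_measurable_def by (simp only:) (rule borel_measurable_indicator, simp)
  moreover have "indicat_real {-L..L} x *\<^sub>R (limit_velocity L x)\<^sup>2 = indicat_real {-1/2..1/2} x" for x
    using eq[of x] assms by (cases "\<bar>x\<bar> \<le> L") (auto simp: indicator_def abs_le_iff)
  then have "set_integrable lebesgue {-L..L} (\<lambda>x. (limit_velocity L x)\<^sup>2)"
    unfolding set_integrable_def by (simp add: integrable_real_indicator)
  moreover have "limit_velocity L (- x) = limit_velocity L x \<and> limit_velocity L x \<ge> limit_velocity L y \<and> limit_velocity L y \<ge> 0"
    if "0 \<le> x" "x \<le> y" "y \<le> L" for x y
    using that eq[of x] eq[of "- x"] eq[of y] by (auto simp: indicator_def)
  ultimately show ?thesis
    using per unfolding profile_cone_def by auto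
qed

lemma integral_limit_velocity_mult:
  assumes "1 < L" "{a..b} \<subseteq> {- L - 1/2..L + 1/2}"
  shows "integral {a..b} (\<lambda>x. f x * limit_velocity L x) = integral ({-1/2..1/2} \<inter> {a..b}) f"
proof -
  have "integral {a..b} (\<lambda>x. f x * limit_velocity L x) = integral {a..b} (\<lambda>x. if x \<in> {-1/2..1/2} then f x else 0)"
  proof (rule integral_cong)
    fix x assume "x \<in> {a..b}"
    then have "x \<in> {- L - 1/2..L + 1/2}" using assms(2) by blast
    then have "\<bar>x\<bar> \<le> L + 1/2" unfolding atLeastAtMost_iff by linarith
    then show "f x * limit_velocity L x = (if x \<in> {-1/2..1/2} then f x else 0)"
      using limit_velocity_eq_indicator[OF assms(1)] by simp
  qed
  also have "\<dots> = integral ({-1/2..1/2} \<inter> {a..b}) f"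
    by (rule Henstock_Kurzweil_Integration.integral_restrict_Int)
  finally show ?thesis .
qed

lemma L2_norm_limit_velocity:
  assumes "1 < L"
  shows "L2_norm_on L (limit_velocity L) = 1"
proof -
  have P: "periodic_L2 L (limit_velocity L)"
    using assms by (intro profile_cone_periodic_L2 limit_velocity_in_cone) auto
  have "integral {-L..L} (\<lambda>x. (limit_velocity L x)\<^sup>2) = integral {-L..L} (\<lambda>x. 1 * limit_velocity L x)"
    by (rule integral_cong) (simp add: indicator_def limit_velocity_def)
  also have "\<dots> = integral ({-1/2..1/2} \<inter> {-L..L}) (\<lambda>_. 1)"
    using assms by (intro integral_limit_velocity_mult) auto
  also have "{-1/2..1/2} \<inter> {-L..L} = {-1/2..1/2}"
    using assms by auto
  finally show ?thesis
    by (simp add: L2_norm_on_eq[OF P])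
qed

lemma limit_distance_eq:
  assumes "1 < L" "x \<in> {-L..L}"
  shows "limit_distance L x = max 0 (1 - \<bar>x\<bar>)"
proof -
  have P: "periodic_L2 L (limit_velocity L)"
    using assms by (intro profile_cone_periodic_L2 limit_velocity_in_cone) auto
  have "limit_distance L x = integral {x - 1/2..x + 1/2} (\<lambda>x. 1 * limit_velocity L x)"
    unfolding limit_distance_def avg_eq_integral[OF P] by simp
  also have "\<dots> = integral ({-1/2..1/2} \<inter> {x - 1/2..x + 1/2}) (\<lambda>_. 1)"
    using assms by (intro integral_limit_velocity_mult) auto
  also have "\<dots> = max 0 (1 - \<bar>x\<bar>)"
    by (auto simp: Int_atLeastAtMost max_def min_def)
  finally show ?thesis .
qed

text \<open>
  For two unit vectors the distance is determined by the inner product, and the inner product with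
  the indicator of \<open>{-1/2..1/2}\<close> is the average at 0. Hence convergence of this single number
  controls everything.
\<close>

lemma L2_distance_limit_velocity:
  assumes "1 < L" "periodic_L2 L V" "L2_norm_on L V = 1"
  shows "L2_norm_on L (\<lambda>x. V x - limit_velocity L x) = sqrt (2 - 2 * avg V 0)"
proof -
  have P: "periodic_L2 L (limit_velocity L)"
    using assms by (intro profile_cone_periodic_L2 limit_velocity_in_cone) auto
  have "integral {-L..L} (\<lambda>x. V x * limit_velocity L x) = integral ({-1/2..1/2} \<inter> {-L..L}) V"
    using assms by (intro integral_limit_velocity_mult) auto
  also have "{-1/2..1/2} \<inter> {-L..L} = {0 - 1/2..0 + 1/2}"
    using assms by auto
  finally have "integral {-L..L} (\<lambda>x. V x * limit_velocity L x) = avg V 0"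
    unfolding avg_eq_integral[OF assms(2)] .
  then have "integral {-L..L} (\<lambda>x. (V x - 1 * limit_velocity L x)\<^sup>2) = 2 - 2 * avg V 0"
    unfolding integral_power2_diff[OF assms(2) P] integral_power2_eq[OF assms(2)] integral_power2_eq[OF P]
    using assms by (simp add: L2_norm_limit_velocity)
  then show ?thesis
    using L2_norm_on_eq[OF periodic_L2_diff[OF assms(2) P, of 1]] by simp
qed

lemma Linf_norm_on_bounds:
  assumes "0 < L" "continuous_on UNIV f" "\<And>x. \<bar>f x\<bar> \<le> c"
  shows "0 \<le> Linf_norm_on L f" "Linf_norm_on L f \<le> ereal c"
proof -
  have "(\<lambda>x. \<bar>f x\<bar>) \<in> borel_measurable borel"
    using assms(2) by (intro borel_measurable_continuous_onI continuous_intros)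
  then have "(\<lambda>x. ereal \<bar>f x\<bar>) \<in> borel_measurable (lebesgue_on {-L..L})"
    by (intro borel_measurable_ereal measurable_restrict_space1 measurable_completion) simp
  then show "Linf_norm_on L f \<le> ereal c"
    unfolding Linf_norm_on_def by (rule esssup_I) (use assms(3) in simp)
  have "emeasure (lebesgue_on {-L..L}) (space (lebesgue_on {-L..L})) = ennreal (2 * L)"
    using assms(1) by (simp add: emeasure_restrict_space space_restrict_space)
  then have "ae_filter (lebesgue_on {-L..L}) \<noteq> bot"
    unfolding ae_filter_eq_bot_iff using assms(1) by simp
  moreover have "AE x in lebesgue_on {-L..L}. 0 \<le> esssup (lebesgue_on {-L..L}) (\<lambda>x. ereal \<bar>f x\<bar>)"
    by (rule eventually_mono[OF esssup_AE[of "\<lambda>x. ereal \<bar>f x\<bar>" "lebesgue_on {-L..L}"]])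
      (meson abs_ge_zero ereal_less_eq(5) order_trans)
  ultimately show "0 \<le> Linf_norm_on L f"
    unfolding Linf_norm_on_def eventually_const_iff by blast
qed

text \<open>
  The factor \<open>exp\<close> in the force dominates the algebraic factor, so the force at \<open>t / \<delta>\<close> is eventually
  larger than any multiple of the force at \<open>s / \<delta>\<close>.
\<close>

lemma force_growth:
  assumes C: "0 < C" and \<Psi>: "\<And>r. 0 < r \<Longrightarrow> \<bar>\<Psi> r / r powr \<mu> - 1\<bar> \<le> C / r" and st: "0 < s" "s < t"
  shows "\<forall>\<^sub>F \<delta> in at_right 0. K * force \<Psi> (s / \<delta>) < force \<Psi> (t / \<delta>)"
proof -
  define q where "q = (t / s) powr \<mu>"
  \<comment> \<open>The first bound puts both arguments beyond \<open>2 * C\<close>, where \<open>\<Psi> r\<close> lies between half and three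
     halves of \<open>r powr \<mu>\<close>; the second lets \<open>exp ((t - s) / \<delta>)\<close> win over \<open>K\<close> and \<open>q\<close>.\<close>
  define d where "d = min (s / (2 * C)) ((t - s) * q / (3 * (\<bar>K\<bar> + 1)))"
  have q: "0 < q" unfolding q_def using st by simp
  have "0 < d"
    unfolding d_def using C st q by simp
  have asym: "r powr \<mu> / 2 \<le> \<Psi> r" "\<Psi> r \<le> 3 / 2 * r powr \<mu>" if "2 * C \<le> r" for r
  proof -
    have r: "0 < r" using that C by simp
    then have "C / r \<le> 1/2" using that by (simp add: field_simps)
    then have "\<bar>\<Psi> r / r powr \<mu> - 1\<bar> \<le> 1/2" using \<Psi>[OF r] by linarith
    then have "1/2 \<le> \<Psi> r / r powr \<mu>" "\<Psi> r / r powr \<mu> \<le> 3/2" by linarith+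
    then show "r powr \<mu> / 2 \<le> \<Psi> r" "\<Psi> r \<le> 3 / 2 * r powr \<mu>"
      using r by (simp_all add: field_simps)
  qed
  have "K * force \<Psi> (s / \<delta>) < force \<Psi> (t / \<delta>)" if "\<delta> \<in> {0<..<d}" for \<delta>
  proof -
    have \<delta>: "0 < \<delta>" "\<delta> < s / (2 * C)" "\<delta> < (t - s) * q / (3 * (\<bar>K\<bar> + 1))"
      using that unfolding d_def by auto
    define a where "a = s / \<delta>"
    define b where "b = t / \<delta>"
    have a: "2 * C \<le> a" "0 < a"
      using \<delta> C st unfolding a_def by (simp_all add: field_simps)
    have ab: "a \<le> b" unfolding a_def b_def using st \<delta> by (simp add: divide_right_mono)
    have powr: "b powr \<mu> = q * a powr \<mu>"
    proof -
      have "b = (t / s) * a" unfolding a_def b_def using st by simp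
      then show ?thesis
        unfolding q_def using st a powr_mult[of "t / s" a \<mu>] by simp
    qed
    have "3 * (\<bar>K\<bar> + 1) < (b - a) * q"
      using \<delta> unfolding a_def b_def by (simp add: field_simps)
    also have "\<dots> \<le> exp (b - a) * q"
    proof (rule mult_right_mono)
      show "b - a \<le> exp (b - a)" using exp_ge_add_one_self[of "b - a"] by linarith
    qed (use q in simp)
    finally have K: "3 * \<bar>K\<bar> < exp (b - a) * q" by simp
    have "K * force \<Psi> a \<le> \<bar>K\<bar> * (3 / 2 * a powr \<mu> * exp a)"
    proof -
      have "0 \<le> \<Psi> a" using asym(1)[OF a(1)] by (smt (verit) powr_ge_zero divide_nonneg_pos)
      then have "K * force \<Psi> a \<le> \<bar>K\<bar> * force \<Psi> a"
        unfolding force_def by (intro mult_right_mono) auto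
      also have "\<dots> \<le> \<bar>K\<bar> * (3 / 2 * a powr \<mu> * exp a)"
        unfolding force_def using asym(2)[OF a(1)] by (intro mult_left_mono mult_right_mono) auto
      finally show ?thesis .
    qed
    also have "\<dots> = 3 * \<bar>K\<bar> * (a powr \<mu> * exp a / 2)"
      by simp
    also have "\<dots> < exp (b - a) * q * (a powr \<mu> * exp a / 2)"
      using K a by (intro mult_strict_right_mono) auto
    also have "\<dots> = b powr \<mu> / 2 * exp b"
      unfolding powr by (simp add: exp_diff)
    also have "\<dots> \<le> force \<Psi> b"
      unfolding force_def using asym(1)[of b] a ab by (intro mult_right_mono) auto
    finally show ?thesis unfolding a_def b_def .
  qed
  then show ?thesis
    using eventually_at_right_real[OF \<open>0 < d\<close>] by (rule eventually_mono[rotated])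
qed

context convex_potential
begin

text \<open>
  The tent \<open>max 0 (1 - \<bar>x\<bar>)\<close> is at least \<open>1 - \<epsilon>\<close> on \<open>{-\<epsilon>..\<epsilon>}\<close>.
\<close>

lemma potential_energy_limit_velocity_ge:
  assumes "1 < L" "0 < \<delta>" "0 < \<epsilon>" "\<epsilon> \<le> 1"
  shows "2 * L * \<Phi> 0 + 2 * \<epsilon> * (\<Phi> ((1 - \<epsilon>) / \<delta>) - \<Phi> 0) \<le> potential_energy L \<Phi> \<delta> (limit_velocity L)"
proof -
  let ?c = "\<Phi> ((1 - \<epsilon>) / \<delta>) - \<Phi> 0"
  let ?g = "\<lambda>x. if x \<in> {-\<epsilon>..\<epsilon>} then ?c else 0"
  note energy = potential_energy_eq_integral[OF _ \<open>0 < \<delta>\<close> limit_velocity_in_cone[OF assms(1)]]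
  have g: "(?g has_integral 2 * \<epsilon> * ?c) {-L..L}"
  proof -
    have "((\<lambda>_. ?c) has_integral 2 * \<epsilon> * ?c) {-\<epsilon>..\<epsilon>}"
      using has_integral_const_real[of ?c "-\<epsilon>" \<epsilon>] assms by simp
    then show ?thesis
      using assms by (intro has_integral_restrict[THEN iffD2]) auto
  qed
  moreover have "((\<lambda>_. \<Phi> 0) has_integral 2 * L * \<Phi> 0) {-L..L}"
    using has_integral_const_real[of "\<Phi> 0" "-L" L] assms by simp
  ultimately have "((\<lambda>x. \<Phi> 0 + ?g x) has_integral 2 * L * \<Phi> 0 + 2 * \<epsilon> * ?c) {-L..L}"
    by (rule has_integral_add[rotated])
  moreover have "((\<lambda>x. \<Phi> (avg (limit_velocity L) x / \<delta>)) has_integral potential_energy L \<Phi> \<delta> (limit_velocity L)) {-L..L}"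
    using energy assms
    by (auto intro!: integrable_integral integrable_continuous_real intro: continuous_on_subset)
  moreover have "\<Phi> 0 + ?g x \<le> \<Phi> (avg (limit_velocity L) x / \<delta>)" if "x \<in> {-L..L}" for x
  proof -
    have R: "avg (limit_velocity L) x = max 0 (1 - \<bar>x\<bar>)"
      using limit_distance_eq[OF assms(1) that] unfolding limit_distance_def .
    show ?thesis
    proof (cases "x \<in> {-\<epsilon>..\<epsilon>}")
      case True
      then have "(1 - \<epsilon>) / \<delta> \<le> avg (limit_velocity L) x / \<delta>"
        unfolding R using assms by (intro divide_right_mono) auto
      then show ?thesis
        using \<Phi>_mono[of "(1 - \<epsilon>) / \<delta>"] True assms by simp
    next
      case False
      then show ?thesis
        using \<Phi>_mono[of 0 "avg (limit_velocity L) x / \<delta>"] assms unfolding R by auto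
    qed
  qed
  ultimately show ?thesis
    by (rule has_integral_le)
qed

text \<open>
  A maximizer has at least the energy of the indicator, and its own energy is at most
  \<open>2 * L * \<Phi> (avg (V \<delta>) 0 / \<delta>)\<close>. Were the average at 0 bounded away from 1, the growth of the force
  would make the first energy larger than the second.
\<close>

lemma maximizer_avg_tendsto:
  assumes "1 < L"
    and growth: "\<And>s t K. 0 < s \<Longrightarrow> s < t \<Longrightarrow> \<forall>\<^sub>F \<delta> in at_right 0. K * F (s / \<delta>) < F (t / \<delta>)"
    and max: "\<And>\<delta>. 0 < \<delta> \<Longrightarrow> maximizer L \<Phi> \<delta> (V \<delta>)"
  shows "((\<lambda>\<delta>. avg (V \<delta>) 0) \<longlongrightarrow> 1) (at_right 0)"
proof (rule order_tendstoI)
  have V: "V \<delta> \<in> profile_cone L" "L2_norm_on L (V \<delta>) = 1"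
    and best: "potential_energy L \<Phi> \<delta> W \<le> potential_energy L \<Phi> \<delta> (V \<delta>)"
    if "0 < \<delta>" "L2_norm_on L W = 1" "W \<in> profile_cone L" for \<delta> W
    using max[OF that(1)] that unfolding maximizer_def is_arg_max_def by (auto simp: not_less)
  note V = V[OF _ L2_norm_limit_velocity[OF assms(1)] limit_velocity_in_cone[OF assms(1)]]
  have le1: "avg (V \<delta>) 0 \<le> 1" if "0 < \<delta>" for \<delta>
    using avg_le_L2_norm[of L "V \<delta>" 0] profile_cone_periodic_L2[of L "V \<delta>"] V[OF that] assms(1) by simp
  have pos: "\<forall>\<^sub>F \<delta>::real in at_right 0. 0 < \<delta>"
    by (rule eventually_at_right_less)
  show "\<forall>\<^sub>F \<delta> in at_right 0. avg (V \<delta>) 0 < a" if "1 < a" for a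
    using pos by eventually_elim (use le1 that in fastforce)
  fix a :: real assume "a < 1"
  define \<epsilon> where "\<epsilon> = min (1/4) ((1 - a) / 2)"
  have "\<epsilon> \<le> (1 - a) / 2"
    unfolding \<epsilon>_def by (rule min.cobounded2)
  then have \<epsilon>: "0 < \<epsilon>" "\<epsilon> \<le> 1/4" "a \<le> 1 - 2 * \<epsilon>"
    using \<open>a < 1\<close> by (simp_all add: \<epsilon>_def field_simps)
  \<comment> \<open>If \<open>avg (V \<delta>) 0 \<le> s\<close>, the energy of \<open>V \<delta>\<close> is governed by the force at \<open>s / \<delta>\<close>, whereas that of
     the indicator is at least of the order of the force at \<open>t / \<delta>\<close>. The point \<open>t\<close> lies halfway
     between \<open>s\<close> and \<open>1 - \<epsilon>\<close>, which leaves room for one more tangent.\<close>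
  define s t where "s = 1 - 2 * \<epsilon>" and "t = 1 - 3 / 2 * \<epsilon>"
  have st: "0 < s" "s < t" using \<epsilon> unfolding s_def t_def by auto
  show "\<forall>\<^sub>F \<delta> in at_right 0. a < avg (V \<delta>) 0"
    using pos growth[OF st, of "2 * L / \<epsilon>\<^sup>2"]
  proof eventually_elim
    case (elim \<delta>)
    show ?case
    proof (rule ccontr)
      assume "\<not> a < avg (V \<delta>) 0"
      then have small: "avg (V \<delta>) 0 \<le> s" using \<epsilon> unfolding s_def by simp
      have R: "continuous_profile L (avg (V \<delta>))"
        using V[OF elim(1)] assms(1) by (intro continuous_profile_avg) auto
      have "potential_energy L \<Phi> \<delta> (V \<delta>) \<le> 2 * L * \<Phi> (avg (V \<delta>) 0 / \<delta>)"
        using V[OF elim(1)] assms(1) elim(1) by (intro potential_energy_le) auto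
      also have "\<dots> \<le> 2 * L * \<Phi> (s / \<delta>)"
        using small elim(1) assms(1) continuous_profileD(5)[OF R, of 0]
        by (intro mult_left_mono \<Phi>_mono divide_right_mono) auto
      finally have up: "potential_energy L \<Phi> \<delta> (V \<delta>) \<le> 2 * L * \<Phi> (s / \<delta>)" .
      have "2 * \<epsilon> * (\<Phi> ((1 - \<epsilon>) / \<delta>) - \<Phi> 0) \<le> 2 * L * (\<Phi> (s / \<delta>) - \<Phi> 0)"
        using up potential_energy_limit_velocity_ge[OF assms(1) elim(1) \<epsilon>(1)] \<epsilon>(2)
          best[OF elim(1) L2_norm_limit_velocity[OF assms(1)] limit_velocity_in_cone[OF assms(1)]]
        by (simp add: right_diff_distrib)
      also have "\<dots> \<le> 2 * L * (F (s / \<delta>) * (1 / \<delta>))"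
      proof (intro mult_left_mono)
        have "\<Phi> (s / \<delta>) - \<Phi> 0 \<le> F (s / \<delta>) * (s / \<delta>)"
          using \<Phi>_above_tangent[of "s / \<delta>" 0] st elim(1) by simp
        also have "\<dots> \<le> F (s / \<delta>) * (1 / \<delta>)"
          using F_nonneg[of "s / \<delta>"] st elim(1) \<epsilon> unfolding s_def
          by (intro mult_left_mono divide_right_mono) auto
        finally show "\<Phi> (s / \<delta>) - \<Phi> 0 \<le> F (s / \<delta>) * (1 / \<delta>)" .
      qed (use assms(1) in simp)
      finally have 1: "2 * \<epsilon> * (\<Phi> ((1 - \<epsilon>) / \<delta>) - \<Phi> 0) \<le> 2 * L * (F (s / \<delta>) * (1 / \<delta>))" .
      have "F (t / \<delta>) * (\<epsilon> / 2 / \<delta>) = F (t / \<delta>) * ((1 - \<epsilon>) / \<delta> - t / \<delta>)"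
        unfolding t_def by (simp flip: diff_divide_distrib)
      also have "\<dots> \<le> \<Phi> ((1 - \<epsilon>) / \<delta>) - \<Phi> (t / \<delta>)"
        using st elim(1) \<epsilon> by (intro \<Phi>_above_tangent) auto
      also have "\<dots> \<le> \<Phi> ((1 - \<epsilon>) / \<delta>) - \<Phi> 0"
        using \<Phi>_mono[of 0 "t / \<delta>"] st elim(1) by simp
      finally have "2 * \<epsilon> * (F (t / \<delta>) * (\<epsilon> / 2 / \<delta>)) \<le> 2 * \<epsilon> * (\<Phi> ((1 - \<epsilon>) / \<delta>) - \<Phi> 0)"
        using \<epsilon> by (intro mult_left_mono) auto
      with 1 have "2 * \<epsilon> * (F (t / \<delta>) * (\<epsilon> / 2 / \<delta>)) \<le> 2 * L * (F (s / \<delta>) * (1 / \<delta>))"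
        by linarith
      then have "\<epsilon>\<^sup>2 * F (t / \<delta>) \<le> 2 * L * F (s / \<delta>)"
        using elim(1) by (simp add: field_simps power2_eq_square)
      then show False
        using elim(2) \<epsilon>(1) by (simp add: field_simps)
    qed
  qed
qed

lemma maximizers_tendsto_limit:
  assumes "1 < L"
    and growth: "\<And>s t K. 0 < s \<Longrightarrow> s < t \<Longrightarrow> \<forall>\<^sub>F \<delta> in at_right 0. K * F (s / \<delta>) < F (t / \<delta>)"
    and max: "\<And>\<delta>. 0 < \<delta> \<Longrightarrow> maximizer L \<Phi> \<delta> (V \<delta>)"
  shows "((\<lambda>\<delta>. ereal (L2_norm_on L (\<lambda>x. V \<delta> x - limit_velocity L x))
             + Linf_norm_on L (\<lambda>x. avg (V \<delta>) x - limit_distance L x)) \<longlongrightarrow> 0) (at_right 0)"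
proof -
  let ?d = "\<lambda>\<delta>. L2_norm_on L (\<lambda>x. V \<delta> x - limit_velocity L x)"
  let ?e = "\<lambda>\<delta>. Linf_norm_on L (\<lambda>x. avg (V \<delta>) x - limit_distance L x)"
  have P0: "periodic_L2 L (limit_velocity L)"
    using assms by (intro profile_cone_periodic_L2 limit_velocity_in_cone) auto
  have V: "periodic_L2 L (V \<delta>)" "L2_norm_on L (V \<delta>) = 1" if "0 < \<delta>" for \<delta>
    using max[OF that] assms(1) profile_cone_periodic_L2[of L "V \<delta>"]
    unfolding maximizer_def is_arg_max_def by auto
  have pos: "\<forall>\<^sub>F \<delta>::real in at_right 0. 0 < \<delta>"
    by (rule eventually_at_right_less)
  have e: "0 \<le> ?e \<delta>" "?e \<delta> \<le> ereal (?d \<delta>)" if "0 < \<delta>" for \<delta>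
  proof -
    have diff: "periodic_L2 L (\<lambda>x. V \<delta> x - limit_velocity L x)"
      using periodic_L2_diff[OF V(1)[OF that] P0, of 1] by simp
    have eq: "(\<lambda>x. avg (V \<delta>) x - limit_distance L x) = avg (\<lambda>x. V \<delta> x - limit_velocity L x)"
      unfolding limit_distance_def using avg_diff[OF V(1)[OF that] P0] by auto
    show "0 \<le> ?e \<delta>" "?e \<delta> \<le> ereal (?d \<delta>)"
      unfolding eq using assms(1)
      by (auto intro!: Linf_norm_on_bounds avg_continuous[OF diff] avg_le_L2_norm[OF _ diff])
  qed
  have "((\<lambda>\<delta>. 2 * sqrt (2 - 2 * avg (V \<delta>) 0)) \<longlongrightarrow> 2 * sqrt (2 - 2 * 1)) (at_right 0)"
    by (intro tendsto_intros maximizer_avg_tendsto[OF assms])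
  moreover have "\<forall>\<^sub>F \<delta> in at_right 0. 2 * sqrt (2 - 2 * avg (V \<delta>) 0) = 2 * ?d \<delta>"
    using pos by eventually_elim (simp add: L2_distance_limit_velocity[OF assms(1)] V)
  ultimately have "((\<lambda>\<delta>. 2 * ?d \<delta>) \<longlongrightarrow> 2 * sqrt (2 - 2 * 1)) (at_right 0)"
    by (rule Lim_transform_eventually)
  then have "((\<lambda>\<delta>. 2 * ?d \<delta>) \<longlongrightarrow> 0) (at_right 0)"
    by simp
  then have upper: "((\<lambda>\<delta>. ereal (2 * ?d \<delta>)) \<longlongrightarrow> 0) (at_right 0)"
    by (simp add: zero_ereal_def)
  show ?thesis
  proof (rule tendsto_sandwich[OF _ _ tendsto_const upper])
    show "\<forall>\<^sub>F \<delta> in at_right 0. 0 \<le> ereal (?d \<delta>) + ?e \<delta>"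
      using pos
    proof eventually_elim
      case (elim \<delta>)
      have "0 \<le> ?d \<delta>"
        using order_trans[OF e[OF elim]] by simp
      then show ?case using e(1)[OF elim] by (intro add_nonneg_nonneg) auto
    qed
    show "\<forall>\<^sub>F \<delta> in at_right 0. ereal (?d \<delta>) + ?e \<delta> \<le> ereal (2 * ?d \<delta>)"
      using pos
    proof eventually_elim
      case (elim \<delta>)
      have "ereal (?d \<delta>) + ?e \<delta> \<le> ereal (?d \<delta>) + ereal (?d \<delta>)"
        by (intro add_left_mono e(2)[OF elim])
      then show ?case by simp
    qed
  qed
qed

end

section \<open>Traveling waves of maximal energy\<close>

theorem proposition2:
  fixes L \<mu> C :: real and \<Psi> \<Psi>' \<Phi> :: "real \<Rightarrow> real"
  assumes "2 < L"
    and "\<And>r. r \<ge> 0 \<Longrightarrow> \<Psi> r \<ge> 0"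
    and "\<And>r. r \<ge> 0 \<Longrightarrow> (\<Psi> has_real_derivative \<Psi>' r) (at r within {0..})"
    and "continuous_on {0..} \<Psi>'"
    and "\<Psi> 0 = 0"
    and "C > 0"
    and "\<And>r. r > 0 \<Longrightarrow> \<Psi> r > 0"
    and "\<And>r. r > 0 \<Longrightarrow> \<Psi>' r + \<Psi> r \<ge> 0"
    and "\<And>r. r > 0 \<Longrightarrow> \<bar>\<Psi> r / r powr \<mu> - 1\<bar> \<le> C / r"
    and "\<And>r. r \<ge> 0 \<Longrightarrow> (\<Phi> has_real_derivative force \<Psi> r) (at r within {0..})"
  shows
    "(\<forall>\<delta>>0. \<exists>V lam. maximizer L \<Phi> \<delta> V \<and> lam\<^sup>2 > 0 \<and> (let R = avg V in
        (\<forall>x. lam\<^sup>2 * V x = 1 / \<delta> * avg (\<lambda>y. force \<Psi> (avg V y / \<delta>)) x)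
      \<and> (\<forall>x. (R has_real_derivative V (x + 1/2) - V (x - 1/2)) (at x))
      \<and> (\<forall>x. (V has_real_derivative
               1 / (\<delta> * lam\<^sup>2) * (force \<Psi> (R (x + 1/2) / \<delta>) - force \<Psi> (R (x - 1/2) / \<delta>))) (at x))
      \<and> L2_norm_on L V = 1
      \<and> periodic_fun_simple V (2 * L) \<and> periodic_fun_simple R (2 * L)
      \<and> V \<in> profile_cone L \<and> R \<in> profile_cone L
      \<and> (\<forall>x. V x > 0) \<and> (\<forall>x. R x > 0)))
   \<and> (\<forall>V. (\<forall>\<delta>>0. maximizer L \<Phi> \<delta> (V \<delta>)) \<longrightarrow>
        ((\<lambda>\<delta>. ereal (L2_norm_on L (\<lambda>x. V \<delta> x - limit_velocity L x))
             + Linf_norm_on L (\<lambda>x. avg (V \<delta>) x - limit_distance L x)) \<longlongrightarrow> 0) (at_right 0))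
   \<and> (\<forall>x\<in>{-L..L}. limit_distance L x = max 0 (1 - \<bar>x\<bar>))"
proof -
  have cont: "continuous_on {0..} \<Psi>"
    using DERIV_continuous[OF assms(3)] by (simp add: continuous_on_eq_continuous_within)
  then have contF: "continuous_on {0..} (force \<Psi>)"
    unfolding force_def[abs_def] by (intro continuous_intros)
  interpret convex_potential "force \<Psi>" \<Phi>
  proof
    show "force \<Psi> 0 = 0" using assms(5) by (simp add: force_def)
    show "0 < force \<Psi> r" if "0 < r" for r using assms(7)[OF that] by (simp add: force_def)
    show "continuous_on {0..} (force \<Psi>)" by (rule contF)
    show "(\<Phi> has_real_derivative force \<Psi> r) (at r within {0..})" if "0 \<le> r" for r
      by (rule assms(10)[OF that])
    show "force \<Psi> r \<le> force \<Psi> s" if "0 \<le> r" "r \<le> s" for r s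
    proof (rule DERIV_nonneg_imp_increasing_open[OF \<open>r \<le> s\<close>])
      fix x assume "r < x" "x < s"
      then have x: "0 < x" using that by simp
      have "at x within {0..} = at x"
        by (rule at_within_open_subset[of _ "{0<..}"]) (use x in auto)
      then have "(\<Psi> has_real_derivative \<Psi>' x) (at x)"
        using assms(3)[OF less_imp_le[OF x]] by simp
      then have "(force \<Psi> has_real_derivative (\<Psi>' x + \<Psi> x) * exp x) (at x)"
        unfolding force_def[abs_def] by (auto intro!: derivative_eq_intros simp: algebra_simps)
      then show "\<exists>y. (force \<Psi> has_real_derivative y) (at x) \<and> 0 \<le> y"
        using assms(8)[OF x] by (intro exI[of _ "(\<Psi>' x + \<Psi> x) * exp x"]) simp
    next
      show "continuous_on {r..s} (force \<Psi>)"
        by (rule continuous_on_subset[OF contF]) (use that in auto)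
    qed
  qed
  have L: "1 \<le> L" "1 < L" using assms(1) by simp_all
  have growth: "\<forall>\<^sub>F \<delta> in at_right 0. K * force \<Psi> (s / \<delta>) < force \<Psi> (t / \<delta>)"
    if "0 < s" "s < t" for s t K
    by (rule force_growth[OF assms(6,9) that])
  show ?thesis
  proof (intro conjI)
    show "\<forall>V. (\<forall>\<delta>>0. maximizer L \<Phi> \<delta> (V \<delta>)) \<longrightarrow>
        ((\<lambda>\<delta>. ereal (L2_norm_on L (\<lambda>x. V \<delta> x - limit_velocity L x))
             + Linf_norm_on L (\<lambda>x. avg (V \<delta>) x - limit_distance L x)) \<longlongrightarrow> 0) (at_right 0)"
      using maximizers_tendsto_limit[OF L(2) growth] by blast
    show "\<forall>x\<in>{-L..L}. limit_distance L x = max 0 (1 - \<bar>x\<bar>)"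
      using limit_distance_eq[OF L(2)] by blast
  qed (intro allI impI traveling_wave[OF L(1)])
qed

end
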